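(* Let $t\ge1$, $n\ge 1$ and let $H$ be a finite graph. A $t$-PDDS$[H]$ in $\Lambda_n$ exists in each of the following cases: (i) $t=1$, $n\ge 2$, $H=P_k$ with $k\ge 1$; (ii) $t\ge 1$, $n=2$, $H=P_k$ with $k\ge 1$; (iii) $t\ge1$, $n=2$, $H=P_2\square P_k$ with $k\ge 2$; (iv) $t=1$, $n=3r+2$ with $r\ge 0$, $H=P_2\square P_2$; (v) $t=2$, $n=3$, $H=P_2$.
   Context: $\Lambda_n$ is the infinite graph with vertex set $\mathbb{Z}^n$ in which two vertices are adjacent iff their Euclidean distance is $1$; $d$ denotes graph distance. For a graph $\Gamma=(V,E)$ and $S\subset V$, $[S]$ is the induced subgraph on $S$, and $d(v,C)=\min\{d(v,w):w\in C\}$. For $t\ge1$, $S\subset V$ is a $t$-perfect distance-dominating set ($t$-PDDS) in $\Gamma$ if for each $v\in V$ there is a unique component $C_v$ of $[S]$ with $d(v,C_v)\le t$, and there is in $C_v$ a unique vertex $w$ with $d(v,w)=d(v,C_v)$. A $t$-PDDS$[H]$ in $\Lambda_n$ is a $t$-PDDS in $\Lambda_n$ all of whose components are isomorphic to the fixed finite graph $H$. $P_k$ is the path on $k$ vertices ($P_1$ is a single vertex), and $G\square H$ denotes the Cartesian product of graphs. *)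

theory Defs
  imports Complex_Main "HOL-Library.Extended_Nat" "HOL-Library.FuncSet" "HOL-Analysis.L2_Norm"
begin

record 'a sgraph =
  gverts :: "'a set"
  gadj :: "('a \<times> 'a) set"

definition simple_graph :: "'a sgraph \<Rightarrow> bool" where
  "simple_graph G \<longleftrightarrow> gadj G \<subseteq> gverts G \<times> gverts G \<and> sym (gadj G) \<and> irrefl (gadj G)"

definition finite_graph :: "'a sgraph \<Rightarrow> bool" where
  "finite_graph G \<longleftrightarrow> simple_graph G \<and> finite (gverts G)"

definition graph_isomorphic :: "'a sgraph \<Rightarrow> 'b sgraph \<Rightarrow> bool" where
  "graph_isomorphic G H \<longleftrightarrow>
     (\<exists>f. bij_betw f (gverts G) (gverts H) \<and>
          (\<forall>u\<in>gverts G. \<forall>v\<in>gverts G. (u, v) \<in> gadj G \<longleftrightarrow> (f u, f v) \<in> gadj H))"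

definition induced_subgraph :: "'a sgraph \<Rightarrow> 'a set \<Rightarrow> 'a sgraph" where
  "induced_subgraph G S = \<lparr>gverts = S, gadj = gadj G \<inter> S \<times> S\<rparr>"

definition graph_components :: "'a sgraph \<Rightarrow> 'a sgraph set" where
  "graph_components G = {induced_subgraph G {w. (v, w) \<in> (gadj G)\<^sup>*} | v. v \<in> gverts G}"

text \<open>Length of a shortest walk; it is \<open>\<infinity>\<close> if there is no walk, since
  the infimum of the empty set in \<^typ>\<open>enat\<close> is \<open>\<infinity>\<close>.\<close>
definition graph_dist :: "'a sgraph \<Rightarrow> 'a \<Rightarrow> 'a \<Rightarrow> enat" where
  "graph_dist G v w = Inf {enat k | k. (v, w) \<in> gadj G ^^ k}"

text \<open>The infimum is a minimum for nonempty \<open>C\<close>, because \<^typ>\<open>enat\<close> is well-ordered.\<close>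
definition graph_dist_set :: "'a sgraph \<Rightarrow> 'a \<Rightarrow> 'a set \<Rightarrow> enat" where
  "graph_dist_set G v C = (INF w\<in>C. graph_dist G v w)"

text \<open>All distances are taken in the ambient graph \<open>G\<close>, not in the subgraph induced by \<open>S\<close>.\<close>
definition PDDS :: "nat \<Rightarrow> 'a sgraph \<Rightarrow> 'a set \<Rightarrow> bool" where
  "PDDS t G S \<longleftrightarrow> S \<subseteq> gverts G \<and>
     (\<forall>v\<in>gverts G.
        (\<exists>!C. C \<in> graph_components (induced_subgraph G S) \<and>
              graph_dist_set G v (gverts C) \<le> enat t) \<and>
        (\<forall>C \<in> graph_components (induced_subgraph G S).
           graph_dist_set G v (gverts C) \<le> enat t \<longrightarrow>
           (\<exists>!w. w \<in> gverts C \<and> graph_dist G v w = graph_dist_set G v (gverts C))))"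

text \<open>A point of \<open>\<int>\<^sup>n\<close> is a function in \<open>{..<n} \<rightarrow>\<^sub>E UNIV\<close>, so that
  \<open>n\<close> can be an ordinary natural number; \<^const>\<open>L2_set\<close> is the Euclidean norm.\<close>
definition Lambda_graph :: "nat \<Rightarrow> (nat \<Rightarrow> int) sgraph" where
  "Lambda_graph n =
     \<lparr>gverts = {..<n} \<rightarrow>\<^sub>E UNIV,
      gadj = {(x, y). x \<in> {..<n} \<rightarrow>\<^sub>E UNIV \<and> y \<in> {..<n} \<rightarrow>\<^sub>E UNIV \<and>
                      L2_set (\<lambda>i. real_of_int (x i - y i)) {..<n} = 1}\<rparr>"

definition PDDS_of :: "nat \<Rightarrow> nat \<Rightarrow> 'h sgraph \<Rightarrow> (nat \<Rightarrow> int) set \<Rightarrow> bool" where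
  "PDDS_of t n H S \<longleftrightarrow> PDDS t (Lambda_graph n) S \<and>
     (\<forall>C \<in> graph_components (induced_subgraph (Lambda_graph n) S). graph_isomorphic C H)"

definition path_graph :: "nat \<Rightarrow> nat sgraph" where
  "path_graph k =
     \<lparr>gverts = {..<k}, gadj = {(i, j). i < k \<and> j < k \<and> (j = Suc i \<or> i = Suc j)}\<rparr>"

definition cartesian_product :: "'a sgraph \<Rightarrow> 'b sgraph \<Rightarrow> ('a \<times> 'b) sgraph" where
  "cartesian_product G H =
     \<lparr>gverts = gverts G \<times> gverts H,
      gadj = {((a, b), (c, d)). a \<in> gverts G \<and> c \<in> gverts G \<and> b \<in> gverts H \<and> d \<in> gverts H \<and>
                (a = c \<and> (b, d) \<in> gadj H \<or> b = d \<and> (a, c) \<in> gadj G)}\<rparr>"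

lemma simple_graph_path_graph: "simple_graph (path_graph k)"
  by (auto simp: simple_graph_def path_graph_def sym_def irrefl_def)

lemma simple_graph_cartesian_product:
  "simple_graph G \<Longrightarrow> simple_graph H \<Longrightarrow> simple_graph (cartesian_product G H)"
  by (auto simp: simple_graph_def cartesian_product_def sym_def irrefl_def)

lemma simple_graph_Lambda_graph: "simple_graph (Lambda_graph n)"
  by (auto simp: simple_graph_def Lambda_graph_def sym_def irrefl_def L2_set_def power2_commute)

end

theory Submission imports Defs begin

text \<open>
  In every case \<open>H\<close> is a box graph, so let \<open>S\<close> be a union of translates of one box
  \<open>B = \<Prod>\<^sub>i [0, b\<^sub>i]\<close>. Graph distance in \<open>\<Lambda>\<^sub>n\<close> is the \<open>\<ell>\<^sub>1\<close>-distance, hence the nearest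
  vertex in a box is always unique (clamp each coordinate), and all that remains is to tile \<open>\<int>\<^sup>n\<close>
  by translates of the radius-\<open>t\<close> neighbourhood \<open>N\<close> of \<open>B\<close>. Disjointness of the tiles for
  \<open>t \<ge> 1\<close> also separates the boxes, which makes them the components of \<open>[S]\<close>. The translations form
  the kernel of a homomorphism from \<open>\<int>\<^sup>n\<close> to a finite abelian group that is bijective on \<open>N\<close>:
  \<^item> \<open>t = 1\<close>, \<open>P\<^sub>k\<close>: \<open>e\<^sub>i \<mapsto> ik + 1\<close> modulo \<open>(2n - 1)k + 2\<close>;
  \<^item> \<open>n = 2\<close>, \<open>P\<^sub>k\<close>: \<open>(x, y) \<mapsto> (2t + 1)x + y\<close> modulo \<open>(2t + 1)(k + t) - t\<close>;
  \<^item> \<open>n = 2\<close>, \<open>P\<^sub>2 \<box> P\<^sub>k\<close>: the lattice of all \<open>((t + k)A, (t + 1)B)\<close> with \<open>A + B\<close> even;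
  \<^item> \<open>t = 1\<close>, \<open>n = 3r + 2\<close>, \<open>P\<^sub>2 \<box> P\<^sub>2\<close>: the group is \<open>\<int>/12 \<times> \<int>/(2r + 1)\<close>, with \<open>e\<^sub>0 \<mapsto> (2, 0)\<close>,
    \<open>e\<^sub>1 \<mapsto> (3, 0)\<close> and the other \<open>3r\<close> basis vectors going to \<open>(4c, l)\<close> with \<open>c \<in> {0, 1, 2}\<close>,
    \<open>1 \<le> l \<le> r\<close>;
  \<^item> \<open>t = 2\<close>, \<open>n = 3\<close>, \<open>P\<^sub>2\<close>: \<open>(x, y, z) \<mapsto> x + 7y + 11z\<close> modulo 38.
\<close>

section \<open>Distances in the integer lattice\<close>

abbreviation Zpow :: "nat \<Rightarrow> (nat \<Rightarrow> int) set" where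
  "Zpow n \<equiv> {..<n} \<rightarrow>\<^sub>E UNIV"

definition l1_dist :: "nat \<Rightarrow> (nat \<Rightarrow> int) \<Rightarrow> (nat \<Rightarrow> int) \<Rightarrow> int" where
  "l1_dist n v w = (\<Sum>i<n. \<bar>v i - w i\<bar>)"

lemma Zpow_eqI:
  "v \<in> Zpow n \<Longrightarrow> w \<in> Zpow n \<Longrightarrow> (\<And>i. i < n \<Longrightarrow> v i = w i) \<Longrightarrow> v = w"
  by (rule PiE_ext) auto

lemma l1_dist_nonneg: "0 \<le> l1_dist n v w"
  unfolding l1_dist_def by (simp add: sum_nonneg)

lemma l1_dist_triangle: "l1_dist n u w \<le> l1_dist n u v + l1_dist n v w"
  unfolding l1_dist_def sum.distrib[symmetric] by (rule sum_mono) simp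

lemma l1_dist_eq_0_iff:
  assumes "v \<in> Zpow n" "w \<in> Zpow n"
  shows "l1_dist n v w = 0 \<longleftrightarrow> v = w"
proof
  assume "l1_dist n v w = 0"
  then have "\<forall>i\<in>{..<n}. \<bar>v i - w i\<bar> = 0"
    unfolding l1_dist_def by (subst (asm) sum_nonneg_eq_0_iff) auto
  then show "v = w" by (intro Zpow_eqI[OF assms]) auto
qed (simp add: l1_dist_def)

text \<open>Integers satisfy \<open>|x| <= x^2\<close>, so squares summing to 1 bound the absolute
  sum by 1, and it is not 0. Conversely, an absolute sum of 1 bounds every \<open>|d i|\<close> by
  1, where squares and absolute values agree. This replaces Euclidean adjacency by
  l1-adjacency.\<close>

lemma sum_power2_eq_1_iff_sum_abs_eq_1:
  fixes d :: "'a \<Rightarrow> int"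
  assumes "finite A"
  shows "(\<Sum>i\<in>A. (d i)\<^sup>2) = 1 \<longleftrightarrow> (\<Sum>i\<in>A. \<bar>d i\<bar>) = 1"
proof
  have abs_le: "\<bar>x\<bar> \<le> x\<^sup>2" for x :: int
  proof (cases "x = 0")
    case False
    then have "\<bar>x\<bar> * 1 \<le> \<bar>x\<bar> * \<bar>x\<bar>" by (intro mult_left_mono) auto
    then show ?thesis by (simp add: power2_eq_square)
  qed simp
  assume sq: "(\<Sum>i\<in>A. (d i)\<^sup>2) = 1"
  have "(\<Sum>i\<in>A. \<bar>d i\<bar>) \<le> (\<Sum>i\<in>A. (d i)\<^sup>2)" by (intro sum_mono abs_le)
  moreover have "(\<Sum>i\<in>A. \<bar>d i\<bar>) \<noteq> 0"
  proof
    assume "(\<Sum>i\<in>A. \<bar>d i\<bar>) = 0"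
    then have "\<forall>i\<in>A. d i = 0" using assms by (simp add: sum_nonneg_eq_0_iff)
    with sq show False by simp
  qed
  moreover have "(\<Sum>i\<in>A. \<bar>d i\<bar>) \<ge> 0" by (simp add: sum_nonneg)
  ultimately show "(\<Sum>i\<in>A. \<bar>d i\<bar>) = 1" using sq by linarith
next
  assume abs1: "(\<Sum>i\<in>A. \<bar>d i\<bar>) = 1"
  have "(d i)\<^sup>2 = \<bar>d i\<bar>" if "i \<in> A" for i
  proof -
    have "\<bar>d i\<bar> \<le> 1" using abs1 member_le_sum[of i A "\<lambda>i. \<bar>d i\<bar>"] that assms by simp
    then have "d i = 0 \<or> d i = 1 \<or> d i = -1" by linarith
    then show ?thesis by auto
  qed
  with abs1 show "(\<Sum>i\<in>A. (d i)\<^sup>2) = 1" by simp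
qed

lemma Lambda_adj_iff:
  "(v, w) \<in> gadj (Lambda_graph n) \<longleftrightarrow> v \<in> Zpow n \<and> w \<in> Zpow n \<and> l1_dist n v w = 1"
proof -
  have "L2_set (\<lambda>i. real_of_int (v i - w i)) {..<n} = 1 \<longleftrightarrow>
        real_of_int (\<Sum>i<n. (v i - w i)\<^sup>2) = real_of_int 1"
    unfolding L2_set_def by simp
  also have "\<dots> \<longleftrightarrow> (\<Sum>i<n. (v i - w i)\<^sup>2) = 1" by (rule of_int_eq_iff)
  also have "\<dots> \<longleftrightarrow> l1_dist n v w = 1"
    unfolding l1_dist_def by (rule sum_power2_eq_1_iff_sum_abs_eq_1) simp
  finally show ?thesis by (simp add: Lambda_graph_def)
qed

lemma Lambda_verts [simp]: "gverts (Lambda_graph n) = Zpow n"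
  by (simp add: Lambda_graph_def)

lemma l1_dist_le_walk_length:
  "(v, w) \<in> gadj (Lambda_graph n) ^^ k \<Longrightarrow> l1_dist n v w \<le> int k"
proof (induction k arbitrary: w)
  case 0
  then show ?case by (simp add: l1_dist_def)
next
  case (Suc k)
  then obtain u where "(v, u) \<in> gadj (Lambda_graph n) ^^ k" "(u, w) \<in> gadj (Lambda_graph n)"
    by auto
  with Suc.IH[of u] l1_dist_triangle[of n v w u] show ?case by (simp add: Lambda_adj_iff)
qed

text \<open>Moving one coordinate at a time never leaves a product of order-convex sets; this serves
  both for distances in \<open>\<int>\<^sup>n\<close> and for the connectedness of boxes.\<close>
lemma walk_in_product:
  fixes A :: "nat \<Rightarrow> int set"
  assumes conv: "\<And>i x y z. x \<in> A i \<Longrightarrow> z \<in> A i \<Longrightarrow> x \<le> y \<Longrightarrow> y \<le> z \<Longrightarrow> y \<in> A i"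
    and "v \<in> PiE {..<n} A" "w \<in> PiE {..<n} A" "l1_dist n v w = int k"
  shows "(v, w) \<in> (gadj (Lambda_graph n) \<inter> PiE {..<n} A \<times> PiE {..<n} A) ^^ k"
  using assms(2-)
proof (induction k arbitrary: v)
  case 0
  then have "v \<in> Zpow n" "w \<in> Zpow n" by (simp_all add: PiE_iff)
  with 0 show ?case by (simp add: l1_dist_eq_0_iff)
next
  case (Suc k)
  have "\<exists>j<n. v j \<noteq> w j"
  proof (rule ccontr)
    assume "\<not> ?thesis"
    with Suc.prems(3) show False by (simp add: l1_dist_def)
  qed
  then obtain j where j: "j < n" "v j \<noteq> w j" by blast
  define u where "u = v(j := if v j < w j then v j + 1 else v j - 1)"
  have mem: "v j \<in> A j" "w j \<in> A j" using Suc.prems j by auto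
  have "(if v j < w j then v j + 1 else v j - 1) \<in> A j"
    using j conv[OF mem, of "v j + 1"] conv[OF mem(2,1), of "v j - 1"] by auto
  then have u: "u \<in> PiE {..<n} A"
    using Suc.prems(1) j(1) unfolding u_def PiE_iff extensional_def by auto
  have split: "l1_dist n x y = \<bar>x j - y j\<bar> + (\<Sum>i\<in>{..<n}-{j}. \<bar>x i - y i\<bar>)" for x y
    unfolding l1_dist_def using j(1) by (simp add: sum.remove)
  have rest: "(\<Sum>i\<in>{..<n}-{j}. \<bar>u i - y i\<bar>) = (\<Sum>i\<in>{..<n}-{j}. \<bar>v i - y i\<bar>)" for y
    by (rule sum.cong) (auto simp: u_def)
  have "(\<Sum>i\<in>{..<n}-{j}. \<bar>v i - u i\<bar>) = 0"
    by (rule sum.neutral) (auto simp: u_def)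
  then have "l1_dist n v u = 1" unfolding split by (simp add: u_def)
  moreover have "l1_dist n u w = int k"
    using Suc.prems(3) j unfolding split rest by (simp add: u_def) linarith
  moreover have "v \<in> Zpow n" "u \<in> Zpow n" using Suc.prems(1) u by (simp_all add: PiE_iff)
  ultimately show ?case
    using Suc.IH[OF u Suc.prems(2)] Suc.prems(1) u
    by (intro relpow_Suc_I2[of v u]) (simp_all add: Lambda_adj_iff)
qed

text \<open>Each edge changes the l1-distance by at most 1, so no walk is shorter;
  \<open>walk_in_product\<close> with all factors \<open>UNIV\<close> supplies a walk of exactly
  this length.\<close>

lemma Lambda_dist:
  assumes "v \<in> Zpow n" "w \<in> Zpow n"
  shows "graph_dist (Lambda_graph n) v w = enat (nat (l1_dist n v w))"
proof -
  define k where "k = nat (l1_dist n v w)"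
  then have k: "l1_dist n v w = int k" using l1_dist_nonneg by simp
  have "(v, w) \<in> (gadj (Lambda_graph n) \<inter> Zpow n \<times> Zpow n) ^^ k"
    by (rule walk_in_product) (use assms k in auto)
  moreover have "gadj (Lambda_graph n) \<inter> Zpow n \<times> Zpow n = gadj (Lambda_graph n)"
    by (auto simp: Lambda_adj_iff)
  ultimately have "(v, w) \<in> gadj (Lambda_graph n) ^^ k" by simp
  then show ?thesis unfolding graph_dist_def k_def[symmetric]
    using l1_dist_le_walk_length[where v=v and w=w and n=n] k
    by (intro antisym Inf_lower Inf_greatest) auto
qed

section \<open>Boxes\<close>

text \<open>\<open>b i\<close> is the number of edges along side \<open>i\<close>, one less than the
  number of points, so \<open>b i = 0\<close> makes the box flat in that direction. \<open>l\<close>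
  is the lowest corner.\<close>

definition box :: "nat \<Rightarrow> (nat \<Rightarrow> int) \<Rightarrow> (nat \<Rightarrow> int) \<Rightarrow> (nat \<Rightarrow> int) set" where
  "box n b l = (\<Pi>\<^sub>E i\<in>{..<n}. {l i..l i + b i})"

text \<open>The distance of the integer \<open>u\<close> from the interval \<open>[0, b]\<close>.\<close>
definition excess :: "int \<Rightarrow> int \<Rightarrow> int" where
  "excess b u = max 0 (max (- u) (u - b))"

lemma excess_nonneg [simp]: "0 \<le> excess b u"
  by (simp add: excess_def)

lemma excess_0 [simp]: "excess 0 u = \<bar>u\<bar>"
  by (auto simp: excess_def)

text \<open>Triangle inequality through the nearest points of \<open>[0, b]\<close>. It bounds the
  l1-distance between two points of one neighbourhood, which is how overlaps of tiles are excluded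
  below.\<close>

lemma abs_diff_le_excess: "0 \<le> b \<Longrightarrow> \<bar>u - u'\<bar> \<le> b + excess b u + excess b u'"
  unfolding excess_def by linarith

definition box_dist :: "nat \<Rightarrow> (nat \<Rightarrow> int) \<Rightarrow> (nat \<Rightarrow> int) \<Rightarrow> (nat \<Rightarrow> int) \<Rightarrow> int" where
  "box_dist n b l v = (\<Sum>i<n. excess (b i) (v i - l i))"

lemma box_iff: "w \<in> box n b l \<longleftrightarrow> w \<in> Zpow n \<and> (\<forall>i<n. l i \<le> w i \<and> w i \<le> l i + b i)"
  by (auto simp: box_def PiE_iff)

lemma box_subset_Zpow: "box n b l \<subseteq> Zpow n"
  by (auto simp: box_iff)

lemma box_dist_eq_0: "w \<in> box n b l \<Longrightarrow> box_dist n b l w = 0"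
  unfolding box_dist_def box_iff by (rule sum.neutral) (force simp: excess_def)

lemma box_dist_le_l1_dist:
  assumes "w \<in> box n b l"
  shows "box_dist n b l v \<le> l1_dist n v w"
  unfolding box_dist_def l1_dist_def
proof (rule sum_mono)
  fix i assume "i \<in> {..<n}"
  then have "l i \<le> w i \<and> w i \<le> l i + b i" using assms by (simp add: box_iff)
  then show "excess (b i) (v i - l i) \<le> \<bar>v i - w i\<bar>" unfolding excess_def by linarith
qed

text \<open>Existence is coordinatewise clamping. For uniqueness, each \<open>|v i - w i|\<close> is
  at least the excess of coordinate \<open>i\<close>; equal sums force equality in every coordinate,
  and the nearest point of an interval is unique.\<close>

lemma unique_nearest_box_vertex:
  assumes b: "\<forall>i. 0 \<le> b i" and v: "v \<in> Zpow n"
  shows "\<exists>!w. w \<in> box n b l \<and> l1_dist n v w = box_dist n b l v"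
proof -
  define c where "c = (\<lambda>i\<in>{..<n}. max (l i) (min (v i) (l i + b i)))"
  show ?thesis
  proof (rule ex1I[of _ c])
    have "excess (b i) (v i - l i) = \<bar>v i - c i\<bar>" if "i < n" for i
      using that b[rule_format, of i] unfolding excess_def c_def by simp
    then show "c \<in> box n b l \<and> l1_dist n v c = box_dist n b l v"
      using b by (simp add: c_def box_iff l1_dist_def box_dist_def)
  next
    fix w assume w: "w \<in> box n b l \<and> l1_dist n v w = box_dist n b l v"
    have wi: "l i \<le> w i \<and> w i \<le> l i + b i" if "i < n" for i using w that by (simp add: box_iff)
    have le: "excess (b i) (v i - l i) \<le> \<bar>v i - w i\<bar>" if "i < n" for i
      using wi[OF that] unfolding excess_def by linarith
    have "(\<Sum>i<n. \<bar>v i - w i\<bar> - excess (b i) (v i - l i)) = 0"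
      using w by (simp add: sum_subtractf l1_dist_def box_dist_def)
    then have "\<forall>i\<in>{..<n}. \<bar>v i - w i\<bar> - excess (b i) (v i - l i) = 0"
      by (subst (asm) sum_nonneg_eq_0_iff) (use le in auto)
    then have eq: "\<bar>v i - w i\<bar> = excess (b i) (v i - l i)" if "i < n" for i using that by simp
    have "w i = c i" if "i < n" for i
      using wi[OF that] eq[OF that] that unfolding excess_def c_def by simp linarith
    moreover have "w \<in> Zpow n" "c \<in> Zpow n" using w by (simp_all add: box_iff c_def)
    ultimately show "w = c" by (intro Zpow_eqI) auto
  qed
qed

lemma graph_dist_set_box:
  assumes b: "\<forall>i. 0 \<le> b i" and v: "v \<in> Zpow n"
  shows "graph_dist_set (Lambda_graph n) v (box n b l) = enat (nat (box_dist n b l v))"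
proof -
  have d: "graph_dist (Lambda_graph n) v w = enat (nat (l1_dist n v w))" if "w \<in> box n b l" for w
    using that box_subset_Zpow v by (blast intro: Lambda_dist)
  obtain c where "c \<in> box n b l" "l1_dist n v c = box_dist n b l v"
    using unique_nearest_box_vertex[OF b v, where l=l] by blast
  then have "graph_dist_set (Lambda_graph n) v (box n b l) \<le> enat (nat (box_dist n b l v))"
    unfolding graph_dist_set_def by (intro INF_lower2[of c]) (auto simp: d)
  moreover have "enat (nat (box_dist n b l v)) \<le> graph_dist_set (Lambda_graph n) v (box n b l)"
    unfolding graph_dist_set_def
    by (intro INF_greatest) (auto simp: d box_dist_le_l1_dist nat_mono)
  ultimately show ?thesis by (rule antisym)
qed

section \<open>From tilings to perfect distance-dominating sets\<close>

text \<open>The tiles are the radius-\<open>t\<close> neighbourhoods of the boxes, not the boxes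
  themselves; \<open>L\<close> is the set of lowest corners.\<close>

definition box_tiling :: "nat \<Rightarrow> nat \<Rightarrow> (nat \<Rightarrow> int) \<Rightarrow> (nat \<Rightarrow> int) set \<Rightarrow> bool" where
  "box_tiling t n b L \<longleftrightarrow> (\<forall>v\<in>Zpow n. \<exists>!l. l \<in> L \<and> box_dist n b l v \<le> int t)"

text \<open>A walk cannot leave its box: the tail of an edge from box \<open>l\<close> into box
  \<open>l'\<close> is at distance 0 from the former and at most 1 from the latter, so
  \<open>t >= 1\<close> and uniqueness of the tile give \<open>l = l'\<close>. Conversely, a box is
  connected because monotone walks stay inside it.\<close>

lemma box_component:
  assumes til: "box_tiling t n b L" and t: "t \<ge> 1"
    and l: "l \<in> L" and v: "v \<in> box n b l"
  shows "{w. (v, w) \<in> (gadj (induced_subgraph (Lambda_graph n) (\<Union>(box n b ` L))))\<^sup>*} = box n b l"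
    (is "{w. (v, w) \<in> ?R\<^sup>*} = _")
proof (intro equalityI subsetI)
  fix w assume "w \<in> {w. (v, w) \<in> ?R\<^sup>*}"
  then have "(v, w) \<in> ?R\<^sup>*" by simp
  then show "w \<in> box n b l"
  proof induction
    case (step w w')
    then have w': "w' \<in> Zpow n" "w \<in> Zpow n" "l1_dist n w w' = 1" "w' \<in> \<Union>(box n b ` L)"
      by (auto simp: induced_subgraph_def Lambda_adj_iff)
    then obtain l' where l': "l' \<in> L" "w' \<in> box n b l'" by auto
    have "box_dist n b l' w \<le> int t" using box_dist_le_l1_dist[OF l'(2), of w] w'(3) t by simp
    moreover have "box_dist n b l w \<le> int t" using box_dist_eq_0[OF step.IH] by simp
    ultimately have "l = l'" using til w'(2) l l'(1) unfolding box_tiling_def by blast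
    then show ?case using l'(2) by simp
  qed (rule v)
next
  fix w assume w: "w \<in> box n b l"
  have "(v, w) \<in> (gadj (Lambda_graph n) \<inter> box n b l \<times> box n b l) ^^ nat (l1_dist n v w)"
    unfolding box_def
    by (rule walk_in_product) (use v w l1_dist_nonneg in \<open>simp_all add: box_def\<close>)
  then have "(v, w) \<in> (gadj (Lambda_graph n) \<inter> box n b l \<times> box n b l)\<^sup>*"
    by (rule relpow_imp_rtrancl)
  moreover have "gadj (Lambda_graph n) \<inter> box n b l \<times> box n b l \<subseteq> ?R"
    using l by (auto simp: induced_subgraph_def)
  ultimately show "w \<in> {w. (v, w) \<in> ?R\<^sup>*}" using rtrancl_mono by blast
qed

lemma box_components:
  assumes til: "box_tiling t n b L" and t: "t \<ge> 1" and b: "\<forall>i. 0 \<le> b i"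
  shows "graph_components (induced_subgraph (Lambda_graph n) (\<Union>(box n b ` L))) =
         (\<lambda>l. induced_subgraph (Lambda_graph n) (box n b l)) ` L"
    (is "graph_components ?G = _")
proof -
  have ind: "induced_subgraph ?G (box n b l) = induced_subgraph (Lambda_graph n) (box n b l)"
    if "l \<in> L" for l using that by (auto simp: induced_subgraph_def)
  have verts: "gverts ?G = \<Union>(box n b ` L)" by (simp add: induced_subgraph_def)
  \<comment> \<open>Boxes are nonempty, so every \<open>l\<close> in \<open>L\<close> contributes a
    component. The restriction puts the corner into \<open>Zpow n\<close>, since \<open>l\<close>
    itself may be nonextensional.\<close>
  have corner: "restrict l {..<n} \<in> box n b l" for l using b by (simp add: box_iff)
  show ?thesis
    unfolding graph_components_def verts
  proof (intro equalityI subsetI)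
    fix C assume "C \<in> {induced_subgraph ?G {w. (v, w) \<in> (gadj ?G)\<^sup>*} |v. v \<in> \<Union>(box n b ` L)}"
    then obtain v l where "l \<in> L" "v \<in> box n b l"
      "C = induced_subgraph ?G {w. (v, w) \<in> (gadj ?G)\<^sup>*}" by blast
    then show "C \<in> (\<lambda>l. induced_subgraph (Lambda_graph n) (box n b l)) ` L"
      using box_component[OF til t] ind by auto
  next
    fix C assume "C \<in> (\<lambda>l. induced_subgraph (Lambda_graph n) (box n b l)) ` L"
    then obtain l where l: "l \<in> L" "C = induced_subgraph ?G (box n b l)" using ind by auto
    then have "C = induced_subgraph ?G {w. (restrict l {..<n}, w) \<in> (gadj ?G)\<^sup>*}"
      using box_component[OF til t l(1) corner] by simp
    with l(1) corner[of l]
    show "C \<in> {induced_subgraph ?G {w. (v, w) \<in> (gadj ?G)\<^sup>*} |v. v \<in> \<Union>(box n b ` L)}"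
      by blast
  qed
qed

text \<open>The unique component within distance \<open>t\<close> is the tiling property; the unique
  nearest vertex exists for every box by clamping, at whatever distance.\<close>

lemma PDDS_box_tiling:
  assumes til: "box_tiling t n b L" and t: "t \<ge> 1" and b: "\<forall>i. 0 \<le> b i"
  shows "PDDS t (Lambda_graph n) (\<Union>(box n b ` L))"
proof -
  let ?B = "\<lambda>l. induced_subgraph (Lambda_graph n) (box n b l)"
  have verts: "gverts (?B l) = box n b l" for l by (simp add: induced_subgraph_def)
  have dist: "graph_dist_set (Lambda_graph n) v (gverts (?B l)) \<le> enat t \<longleftrightarrow>
      box_dist n b l v \<le> int t" if "v \<in> Zpow n" for v l
    using graph_dist_set_box[OF b that] by (simp add: verts nat_le_iff)
  have "\<exists>!C. C \<in> ?B ` L \<and> graph_dist_set (Lambda_graph n) v (gverts C) \<le> enat t"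
    if v: "v \<in> Zpow n" for v
  proof -
    obtain l where "l \<in> L" "box_dist n b l v \<le> int t"
      "\<And>l'. l' \<in> L \<Longrightarrow> box_dist n b l' v \<le> int t \<Longrightarrow> l' = l"
      using til v unfolding box_tiling_def by metis
    then show ?thesis using dist[OF v] by (intro ex1I[of _ "?B l"]) blast+
  qed
  moreover have "\<exists>!w. w \<in> gverts (?B l) \<and>
      graph_dist (Lambda_graph n) v w = graph_dist_set (Lambda_graph n) v (gverts (?B l))"
    if v: "v \<in> Zpow n" for v l
  proof -
    have "graph_dist (Lambda_graph n) v w = enat (nat (box_dist n b l v)) \<longleftrightarrow>
        l1_dist n v w = box_dist n b l v" if "w \<in> box n b l" for w
      using Lambda_dist[OF v, of w] that box_subset_Zpow[of n b l] l1_dist_nonneg[of n v w]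
      by (auto simp: box_dist_def sum_nonneg eq_nat_nat_iff)
    then show ?thesis
      using unique_nearest_box_vertex[OF b v, where l=l]
      unfolding verts graph_dist_set_box[OF b v] by (metis (no_types, lifting))
  qed
  moreover have "\<Union>(box n b ` L) \<subseteq> Zpow n" using box_subset_Zpow by blast
  ultimately show ?thesis
    unfolding PDDS_def box_components[OF til t b] by auto
qed

section \<open>Boxes as paths and ladders up to isomorphism\<close>

lemma graph_isomorphic_sym:
  assumes "graph_isomorphic G H" shows "graph_isomorphic H G"
proof -
  obtain f where f: "bij_betw f (gverts G) (gverts H)"
    and adj: "\<forall>u\<in>gverts G. \<forall>v\<in>gverts G. (u, v) \<in> gadj G \<longleftrightarrow> (f u, f v) \<in> gadj H"
    using assms by (auto simp: graph_isomorphic_def)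
  let ?g = "inv_into (gverts G) f"
  have "bij_betw ?g (gverts H) (gverts G)" using f by (rule bij_betw_inv_into)
  moreover have "(u, v) \<in> gadj H \<longleftrightarrow> (?g u, ?g v) \<in> gadj G"
    if "u \<in> gverts H" "v \<in> gverts H" for u v
    using that adj bij_betw_inv_into_right[OF f] bij_betwE[OF bij_betw_inv_into[OF f]] by simp
  ultimately show ?thesis unfolding graph_isomorphic_def by blast
qed

lemma graph_isomorphic_trans:
  assumes "graph_isomorphic G H" "graph_isomorphic H K" shows "graph_isomorphic G K"
proof -
  obtain f g where f: "bij_betw f (gverts G) (gverts H)" and g: "bij_betw g (gverts H) (gverts K)"
    and fadj: "\<forall>u\<in>gverts G. \<forall>v\<in>gverts G. (u, v) \<in> gadj G \<longleftrightarrow> (f u, f v) \<in> gadj H"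
    and gadj: "\<forall>u\<in>gverts H. \<forall>v\<in>gverts H. (u, v) \<in> gadj H \<longleftrightarrow> (g u, g v) \<in> gadj K"
    using assms by (auto simp: graph_isomorphic_def)
  have "\<forall>u\<in>gverts G. \<forall>v\<in>gverts G. (u, v) \<in> gadj G \<longleftrightarrow> ((g \<circ> f) u, (g \<circ> f) v) \<in> gadj K"
    using fadj gadj bij_betwE[OF f] by simp
  with bij_betw_trans[OF f g] show ?thesis unfolding graph_isomorphic_def by blast
qed

lemma PDDS_of_box_tiling:
  assumes "box_tiling t n b L" "t \<ge> 1" "\<forall>i. 0 \<le> b i"
    and "\<And>l. graph_isomorphic (induced_subgraph (Lambda_graph n) (box n b l)) P"
    and "graph_isomorphic H P"
  shows "\<exists>S. PDDS_of t n H S"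
proof -
  have "graph_isomorphic C H"
    if "C \<in> graph_components (induced_subgraph (Lambda_graph n) (\<Union>(box n b ` L)))" for C
    using that graph_isomorphic_trans[OF assms(4) graph_isomorphic_sym[OF assms(5)]]
    unfolding box_components[OF assms(1-3)] by blast
  with PDDS_box_tiling[OF assms(1-3)] show ?thesis unfolding PDDS_of_def by blast
qed

lemma sum_lessThan_split_1:
  fixes h :: "nat \<Rightarrow> int"
  assumes "1 \<le> n"
  shows "(\<Sum>i<n. h i) = h 0 + (\<Sum>i=1..<n. h i)"
  using assms by (simp add: lessThan_atLeast0 sum.atLeast_Suc_lessThan)

lemma sum_lessThan_split_2:
  fixes h :: "nat \<Rightarrow> int"
  assumes "2 \<le> n"
  shows "(\<Sum>i<n. h i) = h 0 + h 1 + (\<Sum>i=2..<n. h i)"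
  using assms by (simp add: sum_lessThan_split_1 sum.atLeast_Suc_lessThan numeral_2_eq_2)

lemma path_adj_nat_iff:
  assumes "0 \<le> a" "a < int k" "0 \<le> b" "b < int k"
  shows "(nat a, nat b) \<in> gadj (path_graph k) \<longleftrightarrow> \<bar>a - b\<bar> = 1"
  using assms by (simp add: path_graph_def) linarith

text \<open>Only coordinate 0 varies on this box, so its offset from the corner numbers the path
  vertices and the l1-distance is the difference of the offsets.\<close>

lemma box_isomorphic_path:
  assumes "1 \<le> n"
  shows "graph_isomorphic
    (induced_subgraph (Lambda_graph n) (box n (\<lambda>i. if i = 0 then int k - 1 else 0) l))
    (path_graph k)" (is "graph_isomorphic (induced_subgraph _ ?B) _")
proof -
  define f where "f w = nat (w 0 - l 0)" for w :: "nat \<Rightarrow> int"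
  define g where "g j = (\<lambda>i\<in>{..<n}. if i = 0 then l 0 + int j else l i)" for j :: nat
  have w0: "l 0 \<le> w 0 \<and> w 0 \<le> l 0 + (int k - 1)" if "w \<in> ?B" for w
    using that assms unfolding box_iff by (metis (full_types) less_le_trans zero_less_one)
  have wi: "w i = l i" if "w \<in> ?B" "i < n" "i \<noteq> 0" for w i
    using that unfolding box_iff by (smt (verit))
  have "bij_betw f ?B {..<k}"
  proof (rule bij_betw_byWitness[where f' = g])
    show "\<forall>w\<in>?B. g (f w) = w"
    proof
      fix w assume w: "w \<in> ?B"
      then have "w \<in> Zpow n" by (simp add: box_iff)
      moreover have "g (f w) \<in> Zpow n" by (simp add: g_def)
      ultimately show "g (f w) = w"
        using w0[OF w] wi[OF w] by (intro Zpow_eqI[of _ n]) (auto simp: f_def g_def)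
    qed
    show "\<forall>j\<in>{..<k}. f (g j) = j" using assms by (simp add: f_def g_def)
    show "f ` ?B \<subseteq> {..<k}" using w0 by (force simp: f_def)
    show "g ` {..<k} \<subseteq> ?B" by (auto simp: g_def box_iff)
  qed
  moreover have "(v, w) \<in> gadj (Lambda_graph n) \<longleftrightarrow> (f v, f w) \<in> gadj (path_graph k)"
    if v: "v \<in> ?B" and w: "w \<in> ?B" for v w
  proof -
    have "l1_dist n v w = \<bar>v 0 - w 0\<bar>"
      using assms wi[OF v] wi[OF w] by (simp add: l1_dist_def sum_lessThan_split_1)
    then have "(v, w) \<in> gadj (Lambda_graph n) \<longleftrightarrow> \<bar>v 0 - w 0\<bar> = 1"
      using v w by (simp add: Lambda_adj_iff box_iff)
    also have "\<dots> \<longleftrightarrow> (f v, f w) \<in> gadj (path_graph k)"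
      using w0[OF v] w0[OF w] by (simp add: f_def path_adj_nat_iff)
    finally show ?thesis .
  qed
  ultimately show ?thesis
    unfolding graph_isomorphic_def by (auto simp: induced_subgraph_def path_graph_def)
qed

text \<open>Coordinate 1 is the \<open>P_2\<close> factor and coordinate 0 the \<open>P_k\<close>
  factor, hence the swapped order in \<open>f\<close>. Two absolute values sum to 1 iff one is 1 and
  the other 0, which is adjacency in the product.\<close>

lemma box_isomorphic_ladder:
  assumes "2 \<le> n"
  shows "graph_isomorphic
    (induced_subgraph (Lambda_graph n)
      (box n (\<lambda>i. if i = 0 then int k - 1 else if i = 1 then 1 else 0) l))
    (cartesian_product (path_graph 2) (path_graph k))"
    (is "graph_isomorphic (induced_subgraph _ ?B) _")
proof -
  define f where "f w = (nat (w 1 - l 1), nat (w 0 - l 0))" for w :: "nat \<Rightarrow> int"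
  define g where "g = (\<lambda>(a, j). \<lambda>i\<in>{..<n}.
    if i = 0 then l 0 + int j else if i = 1 then l 1 + int a else l i)"
  have w0: "l 0 \<le> w 0 \<and> w 0 \<le> l 0 + (int k - 1)" if "w \<in> ?B" for w
    using that assms unfolding box_iff by (auto dest: spec[of _ 0])
  have w1: "l 1 \<le> w 1 \<and> w 1 \<le> l 1 + 1" if "w \<in> ?B" for w
    using that assms unfolding box_iff by (auto dest: spec[of _ 1])
  have wi: "w i = l i" if "w \<in> ?B" "i < n" "i \<noteq> 0" "i \<noteq> 1" for w i
    using that unfolding box_iff by (smt (verit))
  have "bij_betw f ?B ({..<2} \<times> {..<k})"
  proof (rule bij_betw_byWitness[where f' = g])
    show "\<forall>w\<in>?B. g (f w) = w"
    proof
      fix w assume w: "w \<in> ?B"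
      then have "w \<in> Zpow n" by (simp add: box_iff)
      moreover have "g (f w) \<in> Zpow n" by (simp add: f_def g_def)
      ultimately show "g (f w) = w"
        using w0[OF w] w1[OF w] wi[OF w]
        by (intro Zpow_eqI[of _ n]) (auto simp: f_def g_def)
    qed
    show "\<forall>j\<in>{..<2} \<times> {..<k}. f (g j) = j" using assms by (auto simp: f_def g_def)
    show "f ` ?B \<subseteq> {..<2} \<times> {..<k}" using w0 w1 by (force simp: f_def)
    show "g ` ({..<2} \<times> {..<k}) \<subseteq> ?B" by (auto simp: g_def box_iff)
  qed
  moreover have "(v, w) \<in> gadj (Lambda_graph n) \<longleftrightarrow>
      (f v, f w) \<in> gadj (cartesian_product (path_graph 2) (path_graph k))"
    if v: "v \<in> ?B" and w: "w \<in> ?B" for v w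
  proof -
    have "l1_dist n v w = \<bar>v 0 - w 0\<bar> + \<bar>v 1 - w 1\<bar>"
      using assms wi[OF v] wi[OF w] by (simp add: l1_dist_def sum_lessThan_split_2)
    then have "(v, w) \<in> gadj (Lambda_graph n) \<longleftrightarrow> \<bar>v 0 - w 0\<bar> + \<bar>v 1 - w 1\<bar> = 1"
      using v w by (simp add: Lambda_adj_iff box_iff)
    also have "\<dots> \<longleftrightarrow> v 1 = w 1 \<and> \<bar>v 0 - w 0\<bar> = 1 \<or> v 0 = w 0 \<and> \<bar>v 1 - w 1\<bar> = 1"
      by linarith
    also have "\<dots> \<longleftrightarrow> (f v, f w) \<in> gadj (cartesian_product (path_graph 2) (path_graph k))"
    proof -
      have "nat (v i - l i) = nat (w i - l i) \<longleftrightarrow> v i = w i" if "i = 0 \<or> i = 1" for i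
        using that w0[OF v] w0[OF w] w1[OF v] w1[OF w] by auto
      moreover have "nat (u 0 - l 0) < k \<and> nat (u 1 - l 1) < 2" if "u \<in> ?B" for u
        using w0[OF that] w1[OF that] by linarith
      moreover have
        "(nat (v 0 - l 0), nat (w 0 - l 0)) \<in> gadj (path_graph k) \<longleftrightarrow> \<bar>v 0 - w 0\<bar> = 1"
        using w0[OF v] w0[OF w] by (simp add: path_adj_nat_iff)
      moreover have
        "(nat (v 1 - l 1), nat (w 1 - l 1)) \<in> gadj (path_graph 2) \<longleftrightarrow> \<bar>v 1 - w 1\<bar> = 1"
        using w1[OF v] w1[OF w] by (simp add: path_adj_nat_iff)
      moreover have "gverts (path_graph j) = {..<j}" for j by (simp add: path_graph_def)
      ultimately show ?thesis using v w by (simp add: f_def cartesian_product_def)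
    qed
    finally show ?thesis .
  qed
  ultimately show ?thesis
    unfolding graph_isomorphic_def
    by (auto simp: induced_subgraph_def path_graph_def cartesian_product_def)
qed

section \<open>Lattice tilings\<close>

text \<open>\<open>P\<close> describes a subgroup; \<open>ex\<close> and \<open>uniq\<close> say
  that the neighbourhood of the box at the origin meets every coset exactly once. If
  \<open>x\<close> represents the coset of \<open>v\<close>, the corner is \<open>v - x\<close>; for
  a second corner \<open>l'\<close>, the points \<open>v - l'\<close> and \<open>x\<close> of the
  neighbourhood differ by an element of \<open>P\<close>. \<open>cong\<close> permits restricting
  functions to the first \<open>n\<close> coordinates.\<close>

lemma box_tiling_latticeI:
  fixes P :: "(nat \<Rightarrow> int) \<Rightarrow> bool"
  assumes diff: "\<And>x y. P x \<Longrightarrow> P y \<Longrightarrow> P (\<lambda>i. x i - y i)"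
    and cong: "\<And>x y. (\<And>i. i < n \<Longrightarrow> x i = y i) \<Longrightarrow> P x \<Longrightarrow> P y"
    and ex: "\<And>v. \<exists>x. P (\<lambda>i. v i - x i) \<and> (\<Sum>i<n. excess (b i) (x i)) \<le> int t"
    and uniq: "\<And>x y i. (\<Sum>i<n. excess (b i) (x i)) \<le> int t \<Longrightarrow>
      (\<Sum>i<n. excess (b i) (y i)) \<le> int t \<Longrightarrow> P (\<lambda>i. x i - y i) \<Longrightarrow> i < n \<Longrightarrow> x i = y i"
  shows "box_tiling t n b {l \<in> Zpow n. P l}"
  unfolding box_tiling_def
proof
  fix v :: "nat \<Rightarrow> int"
  obtain x where x: "P (\<lambda>i. v i - x i)" "(\<Sum>i<n. excess (b i) (x i)) \<le> int t" using ex by blast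
  define l where "l = (\<lambda>i\<in>{..<n}. v i - x i)"
  show "\<exists>!l. l \<in> {l \<in> Zpow n. P l} \<and> box_dist n b l v \<le> int t"
  proof (rule ex1I[of _ l])
    have "P l" by (rule cong[OF _ x(1)]) (simp add: l_def)
    then show "l \<in> {l \<in> Zpow n. P l} \<and> box_dist n b l v \<le> int t"
      using x(2) by (simp add: l_def box_dist_def)
  next
    fix l' assume l': "l' \<in> {l \<in> Zpow n. P l} \<and> box_dist n b l' v \<le> int t"
    have "P (\<lambda>i. (v i - x i) - l' i)" using diff[OF x(1)] l' by simp
    then have "P (\<lambda>i. (v i - l' i) - x i)" by (simp add: algebra_simps)
    then have "v i - l' i = x i" if "i < n" for i
      using uniq[of "\<lambda>i. v i - l' i" x i] l' x(2) that by (simp add: box_dist_def)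
    then have "l' i = l i" if "i < n" for i using that by (force simp: l_def)
    then show "l' = l" using l' by (intro Zpow_eqI[of _ n]) (simp_all add: l_def)
  qed
qed

text \<open>Division with remainder, the remainders shifted to start at \<open>lo\<close>.\<close>

lemma ex_mod_in_window:
  fixes a lo z :: int
  assumes "a > 0"
  obtains c where "lo \<le> z - a * c" "z - a * c < lo + a"
proof
  show "lo \<le> z - a * ((z - lo) div a)" "z - a * ((z - lo) div a) < lo + a"
    using mult_div_mod_eq[of a "z - lo"] pos_mod_sign[OF assms, of "z - lo"]
      pos_mod_bound[OF assms, of "z - lo"] by linarith+
qed

section \<open>Paths in the plane, any radius\<close>

text \<open>Division by \<open>2*t+1\<close> turns a suitable representative of the residue into a
  point \<open>(q, y)\<close> of the rectangle \<open>-t <= q < k\<close>, \<open>|y| <= t\<close>.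
  Two left corners of it stick out of the neighbourhood; adding the modulus once carries them onto
  the right cap, which the rectangle misses.\<close>

lemma path_tiling_plane_ex:
  fixes t k z :: int
  assumes "t \<ge> 1" "k \<ge> 1"
  shows "\<exists>u w. (2*t+1)*(k+t) - t dvd z - ((2*t+1)*u + w) \<and> excess (k-1) u + \<bar>w\<bar> \<le> t"
proof -
  define s where "s = 2*t+1"
  have s: "s = 2*t+1" "s > 0" using assms by (simp_all add: s_def)
  \<comment> \<open>This equals \<open>(2*t+1)*k + 2*t^2\<close>, the number of points of the
    neighbourhood.\<close>
  define m where "m = s*(k+t) - t"
  have m_alt: "m = s*k + t*s - t" by (simp add: m_def algebra_simps)
  have "s*k \<ge> s*1" using assms s by (intro mult_left_mono) auto
  moreover have "t*s \<ge> 0" using assms s by simp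
  ultimately have "m > 0" using assms s unfolding m_alt by linarith
  \<comment> \<open>The window starts at the value of \<open>(-t, 0)\<close>, and its end keeps
    \<open>q\<close> below \<open>k\<close>.\<close>
  obtain c where "-(t*s) \<le> z - m*c" "z - m*c < -(t*s) + m"
    using ex_mod_in_window[OF \<open>m > 0\<close>] by blast
  moreover define z' where "z' = z - m*c"
  ultimately have z': "m dvd z - z'" "-(t*s) \<le> z'" "z' < s*k - t"
    unfolding m_alt by simp_all
  obtain q where "-t \<le> z' - s*q" "z' - s*q < -t + s" using ex_mod_in_window[OF s(2)] by blast
  moreover define y where "y = z' - s*q"
  ultimately have z'_eq: "z' = s*q + y" and y: "-t \<le> y" "y \<le> t" using s(1) by simp_all
  have "q < k"
  proof (rule ccontr)
    assume "\<not> q < k"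
    then have "s*q \<ge> s*k" using s by (intro mult_left_mono) auto
    with z'(3) z'_eq y show False by linarith
  qed
  have "q \<ge> -t"
  proof (rule ccontr)
    assume "\<not> q \<ge> -t"
    then have "s*q \<le> s*(-t-1)" using s by (intro mult_left_mono) auto
    also have "\<dots> = -(t*s) - s" by (simp add: algebra_simps)
    finally show False using z'(2) z'_eq y s by linarith
  qed
  have "q = -t \<Longrightarrow> y \<ge> 0" using z'(2) unfolding z'_eq by (simp add: algebra_simps)
  consider "\<bar>y\<bar> + max 0 (-q) \<le> t" | "q < 0" "y > t + q" | "q < 0" "y < -(t+q)" using y by linarith
  then have "\<exists>u w. m dvd z - (s*u + w) \<and> excess (k-1) u + \<bar>w\<bar> \<le> t"
  proof cases
    case 1
    then have "excess (k-1) q + \<bar>y\<bar> \<le> t" using \<open>q < k\<close> by (simp add: excess_def)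
    moreover have "m dvd z - (s*q + y)" using z'(1) z'_eq by simp
    ultimately show ?thesis by blast
  next
    case 2
    \<comment> \<open>Upper left corner: the shift \<open>(k+t, -t)\<close> has weight exactly
      \<open>m\<close>. The lower left corner takes \<open>(k+t-1, t+1)\<close>, of the same weight
      because \<open>s = 2*t+1\<close>.\<close>
    have "excess (k-1) (q+k+t) + \<bar>y-t\<bar> \<le> t"
      using 2 y assms \<open>q \<ge> -t\<close> by (simp add: excess_def)
    moreover have eq: "z - (s*(q+k+t) + (y-t)) = (z - z') - m"
      unfolding z'_eq m_def by (simp add: s(1) algebra_simps)
    have "m dvd z - (s*(q+k+t) + (y-t))" unfolding eq using z'(1) by simp
    ultimately show ?thesis by blast
  next
    case 3
    then have "q \<noteq> -t" using \<open>q = -t \<Longrightarrow> y \<ge> 0\<close> by linarith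
    then have "excess (k-1) (q+k+t-1) + \<bar>y+t+1\<bar> \<le> t"
      using 3 y assms \<open>q \<ge> -t\<close> by (simp add: excess_def)
    moreover have eq: "z - (s*(q+k+t-1) + (y+t+1)) = (z - z') - m"
      unfolding z'_eq m_def by (simp add: s(1) algebra_simps)
    have "m dvd z - (s*(q+k+t-1) + (y+t+1))" unfolding eq using z'(1) by simp
    ultimately show ?thesis by blast
  qed
  then show ?thesis unfolding m_def s_def .
qed

text \<open>By symmetry the quotient \<open>c\<close> of the weight difference by the modulus is
  nonnegative. Size bounds leave \<open>c = 0\<close>, where \<open>|w' - w| < 2*t+1\<close> forces
  equality, and \<open>c = 1\<close>, which would put the points too far apart.\<close>

lemma path_tiling_plane_uniq:
  fixes t k u w u' w' :: int
  assumes tk: "t \<ge> 1" "k \<ge> 1"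
    and N: "excess (k-1) u + \<bar>w\<bar> \<le> t" "excess (k-1) u' + \<bar>w'\<bar> \<le> t"
    and dvd: "(2*t+1)*(k+t) - t dvd (2*t+1)*(u-u') + (w-w')"
  shows "u = u' \<and> w = w'"
proof -
  define s where "s = 2*t+1"
  have s: "s = 2*t+1" "s > 0" using tk by (simp_all add: s_def)
  have "s*(k+t) \<ge> s*2" using tk s by (intro mult_left_mono) auto
  then have m_pos: "s*(k+t) - t > 0" using s tk by linarith
  have *: "c = 0 \<and> u = u' \<and> w = w'"
    if c: "s*(u-u') + (w-w') = (s*(k+t) - t) * c" "c \<ge> 0"
      and N: "excess (k-1) u + \<bar>w\<bar> \<le> t" "excess (k-1) u' + \<bar>w'\<bar> \<le> t" for c u u' w w' :: int
  proof -
    define e where "e = u - u' - (k+t)*c"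
    have e: "s*e = w' - w - t*c" using c(1) unfolding e_def by (simp add: algebra_simps)
    have ge: "s*e \<ge> s*d" if "e \<ge> d" for d using that s by (intro mult_left_mono) auto
    have le: "s*e \<le> s*d" if "e \<le> d" for d using that s by (intro mult_left_mono) auto
    have ww: "\<bar>w\<bar> \<le> t" "\<bar>w'\<bar> \<le> t" "-t \<le> u" "u \<le> k-1+t" "-t \<le> u'" "u' \<le> k-1+t"
      using N unfolding excess_def by linarith+
    \<comment> \<open>The largest weight difference, \<open>s*(k-1+2*t) + 2*t\<close>, is below
      twice the modulus.\<close>
    have "c \<le> 1"
    proof (rule ccontr)
      assume "\<not> c \<le> 1"
      then have "(s*(k+t) - t) * c \<ge> (s*(k+t) - t) * 2"
        using m_pos by (intro mult_left_mono) auto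
      moreover have "s*(u-u') \<le> s*(k-1+2*t)"
        using ww s by (intro mult_left_mono) auto
      moreover have "s*(k+1) \<ge> s*2" using tk s by (intro mult_left_mono) auto
      moreover have "(s*(k+t) - t) * 2 = s*(k-1+2*t) + s*(k+1) - 2*t"
        by (simp add: algebra_simps)
      ultimately show False using c(1) ww tk s by linarith
    qed
    then consider "c = 0" | "c = 1" using c(2) by linarith
    then show ?thesis
    proof cases
      case 1
      then have e': "s*e = w' - w" using e by simp
      then have "e = 0" using ge[of 1] le[of "-1"] ww tk s by linarith
      with 1 e show ?thesis by (simp add: e_def)
    next
      case 2
      then have e': "s*e = w' - w - t" using e by simp
      then have "e \<le> 0" using ge[of 1] ww tk s by linarith
      moreover have "e \<ge> -1" using e' le[of "-2"] ww 2 tk s by linarith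
      ultimately consider "e = 0" | "e = -1" by linarith
      \<comment> \<open>In both cases \<open>|u-u'| + |w-w'| = k + 2*t\<close>, while two points of
        the neighbourhood are at most \<open>k-1 + 2*t\<close> apart.\<close>
      then have False
      proof cases
        case 1
        then have "u = u' + k + t" "w' = w + t" using e \<open>c = 1\<close> by (simp_all add: e_def)
        then show False using N tk unfolding excess_def by linarith
      next
        case 2
        then have "u = u' + k + t - 1" "w' - w - t = -s" using e \<open>c = 1\<close> by (simp_all add: e_def)
        then show False using N tk s(1) unfolding excess_def by linarith
      qed
      then show ?thesis ..
    qed
  qed
  obtain c where c: "s*(u-u') + (w-w') = (s*(k+t) - t) * c" 
    using dvd unfolding s_def[symmetric] by (auto simp: dvd_def)
  show ?thesis
  proof (cases "c \<ge> 0")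
    case True
    with *[OF c _ N] show ?thesis by simp
  next
    case False
    have "s*(u'-u) + (w'-w) = (s*(k+t) - t) * (-c)" using c by (simp add: algebra_simps)
    with *[OF this _ N(2,1)] False show ?thesis by simp
  qed
qed

lemma path_tiling_plane:
  assumes "t \<ge> 1" "k \<ge> 1"
  shows "\<exists>L. box_tiling t 2 (\<lambda>i. if i = 0 then int k - 1 else 0) L"
proof -
  define s where "s = 2 * int t + 1"
  define m where "m = s * (int k + int t) - int t"
  have sum2: "(\<Sum>i<2. excess (if i = 0 then int k - 1 else 0) (x i)) = excess (int k - 1) (x 0) + \<bar>x 1\<bar>"
    for x :: "nat \<Rightarrow> int" by (simp add: sum_lessThan_split_2)
  have "box_tiling t 2 (\<lambda>i. if i = 0 then int k - 1 else 0) {l \<in> Zpow 2. m dvd s * l 0 + l 1}"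
  proof (rule box_tiling_latticeI, unfold sum2)
    fix x y :: "nat \<Rightarrow> int"
    assume "m dvd s * x 0 + x 1" "m dvd s * y 0 + y 1"
    from dvd_diff[OF this] show "m dvd s * (x 0 - y 0) + (x 1 - y 1)"
      by (simp add: algebra_simps)
  next
    fix v :: "nat \<Rightarrow> int"
    obtain u w where uw: "m dvd (s * v 0 + v 1) - (s * u + w)" "excess (int k - 1) u + \<bar>w\<bar> \<le> int t"
      using path_tiling_plane_ex[of "int t" "int k" "s * v 0 + v 1"] assms
      unfolding m_def s_def by auto
    have eq: "(s * v 0 + v 1) - (s * u + w) = s * (v 0 - u) + (v 1 - w)"
      by (simp add: algebra_simps)
    show "\<exists>x :: nat \<Rightarrow> int. m dvd s * (v 0 - x 0) + (v 1 - x 1) \<and>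
        excess (int k - 1) (x 0) + \<bar>x 1\<bar> \<le> int t"
      using uw(2) uw(1)[unfolded eq] by (intro exI[of _ "\<lambda>i. if i = 0 then u else w"] conjI) simp_all
  next
    fix x y :: "nat \<Rightarrow> int" and i :: nat
    assume xy: "excess (int k - 1) (x 0) + \<bar>x 1\<bar> \<le> int t" "excess (int k - 1) (y 0) + \<bar>y 1\<bar> \<le> int t"
      "m dvd s * (x 0 - y 0) + (x 1 - y 1)" and i: "i < 2"
    have "x 0 = y 0 \<and> x 1 = y 1"
      by (rule path_tiling_plane_uniq[OF _ _ xy(1,2) xy(3)[unfolded m_def s_def]]) (use assms in simp_all)
    moreover have "i = 0 \<or> i = 1" using i by linarith
    ultimately show "x i = y i" by blast
  qed simp_all
  then show ?thesis by blast
qed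

section \<open>Ladders in the plane, any radius\<close>

text \<open>Reduction lands in the rectangle \<open>-t <= u <= k-1\<close>,
  \<open>-t <= w <= t+1\<close>. As for paths, its left corners lie outside the neighbourhood and
  are moved onto the right cap, here by the lattice steps \<open>(t+k, -(t+1))\<close> and
  \<open>(t+k, t+1)\<close>.\<close>

lemma ladder_tiling_plane_ex:
  fixes t k x y :: int
  assumes tk: "t \<ge> 1" "k \<ge> 1"
  shows "\<exists>A B. even (A + B) \<and> excess (k-1) (x - (t+k)*A) + excess 1 (y - (t+1)*B) \<le> t"
proof -
  have "t + k > 0" "2*(t+1) > 0" using tk by simp_all
  obtain A where "-t \<le> x - (t+k)*A" "x - (t+k)*A < -t + (t+k)"
    using ex_mod_in_window[OF \<open>t + k > 0\<close>] by blast
  moreover define u where "u = x - (t+k)*A"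
  ultimately have u: "-t \<le> u" "u \<le> k-1" by simp_all
  \<comment> \<open>With \<open>A\<close> fixed, only every second multiple of \<open>t+1\<close> is
    available, so the second coordinate is reduced modulo \<open>2*(t+1)\<close>;
    \<open>B = A + 2*C\<close> has the parity of \<open>A\<close>.\<close>
  obtain C where C: "-t \<le> (y - (t+1)*A) - 2*(t+1)*C" "(y - (t+1)*A) - 2*(t+1)*C < -t + 2*(t+1)"
    using ex_mod_in_window[OF \<open>2*(t+1) > 0\<close>] by blast
  define B where "B = A + 2*C"
  define w where "w = y - (t+1)*B"
  have "(y - (t+1)*A) - 2*(t+1)*C = w" unfolding w_def B_def by (simp add: algebra_simps)
  then have w: "-t \<le> w" "w \<le> t+1" using C by simp_all
  have even: "even (A + B)" by (simp add: B_def)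
  consider "excess (k-1) u + excess 1 w \<le> t"
    | "u < 0" "w > t + 1 + u" | "u < 0" "w < -(t + u)"
  proof -
    have "excess (k-1) u = max 0 (-u)" using u by (simp add: excess_def)
    then show thesis using that u w unfolding excess_def by (cases "u < 0"; cases "w > 0") linarith+
  qed
  then show ?thesis
  proof cases
    case 1
    with even show ?thesis unfolding u_def w_def by blast
  next
    case 2
    have "x - (t+k)*(A-1) = u + t + k" "y - (t+1)*(B+1) = w - t - 1"
      by (simp_all add: u_def w_def algebra_simps)
    moreover have "excess (k-1) (u+t+k) + excess 1 (w-t-1) \<le> t"
      using 2 u w tk unfolding excess_def by linarith
    moreover have "even ((A-1) + (B+1))" using even by simp
    ultimately show ?thesis by metis
  next
    case 3
    have "x - (t+k)*(A-1) = u + t + k" "y - (t+1)*(B-1) = w + t + 1"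
      by (simp_all add: u_def w_def algebra_simps)
    moreover have "excess (k-1) (u+t+k) + excess 1 (w+t+1) \<le> t"
      using 3 u w tk unfolding excess_def by linarith
    moreover have "even ((A-1) + (B-1))" using even by simp
    ultimately show ?thesis by metis
  qed
qed

text \<open>The extent of the neighbourhood gives \<open>|A|, |B| <= 1\<close>, and by parity both
  vanish or both are 1 or -1. The latter means l1-distance \<open>2*t+k+1\<close>, but two points of
  the neighbourhood are at most \<open>2*t+k\<close> apart.\<close>

lemma ladder_tiling_plane_uniq:
  fixes t k u w u' w' A B :: int
  assumes tk: "t \<ge> 1" "k \<ge> 1"
    and N: "excess (k-1) u + excess 1 w \<le> t" "excess (k-1) u' + excess 1 w' \<le> t"
    and AB: "even (A + B)" "u - u' = (t+k)*A" "w - w' = (t+1)*B"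
  shows "u = u' \<and> w = w'"
proof -
  have ww: "-t \<le> u" "u \<le> k-1+t" "-t \<le> u'" "u' \<le> k-1+t" 
       "-t \<le> w" "w \<le> 1+t" "-t \<le> w'" "w' \<le> 1+t"
    using N unfolding excess_def by linarith+
  have small: "-1 \<le> d \<and> d \<le> 1" if "a > 0" "\<bar>a*d\<bar> < 2*a" for a d :: int
  proof -
    have "a * \<bar>d\<bar> < a * 2" using that by (simp add: abs_mult mult.commute)
    then have "\<bar>d\<bar> < 2" using that(1) by (simp only: mult_less_cancel_left_pos)
    then show ?thesis by linarith
  qed
  have "-1 \<le> A \<and> A \<le> 1" by (rule small[of "t+k"]) (use AB(2)[symmetric] ww tk in simp_all)
  moreover have "-1 \<le> B \<and> B \<le> 1" by (rule small[of "t+1"]) (use AB(3)[symmetric] ww tk in simp_all)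
  ultimately have "(A = -1 \<or> A = 0 \<or> A = 1) \<and> (B = -1 \<or> B = 0 \<or> B = 1)" by linarith
  then have "A = 0 \<and> B = 0 \<or> (A = 1 \<or> A = -1) \<and> (B = 1 \<or> B = -1)" using AB(1) by auto
  then show ?thesis
  proof
    assume "(A = 1 \<or> A = -1) \<and> (B = 1 \<or> B = -1)"
    then have "\<bar>u - u'\<bar> = t+k" "\<bar>w - w'\<bar> = t+1" using AB(2,3) tk by auto
    then show ?thesis
      using N tk abs_diff_le_excess[of "k-1" u u'] abs_diff_le_excess[of 1 w w'] by linarith
  qed (use AB in simp)
qed

lemma ladder_tiling_plane:
  assumes "t \<ge> 1" "k \<ge> 1"
  shows "\<exists>L. box_tiling t 2 (\<lambda>i. if i = 0 then int k - 1 else if i = 1 then 1 else 0) L"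
proof -
  let ?P = "\<lambda>x :: nat \<Rightarrow> int. \<exists>A B. even (A + B) \<and> x 0 = (int t + int k) * A \<and> x 1 = (int t + 1) * B"
  have sum2: "(\<Sum>i<2. excess (if i = 0 then int k - 1 else if i = 1 then 1 else 0) (x i)) =
      excess (int k - 1) (x 0) + excess 1 (x 1)" for x :: "nat \<Rightarrow> int"
    by (simp add: sum_lessThan_split_2)
  have "box_tiling t 2 (\<lambda>i. if i = 0 then int k - 1 else if i = 1 then 1 else 0) {l \<in> Zpow 2. ?P l}"
  proof (rule box_tiling_latticeI, unfold sum2)
    fix x y :: "nat \<Rightarrow> int" assume "?P x" "?P y"
    then obtain A B A' B' where "even (A + B)" "x 0 = (int t + int k) * A" "x 1 = (int t + 1) * B"
      "even (A' + B')" "y 0 = (int t + int k) * A'" "y 1 = (int t + 1) * B'" by blast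
    moreover have "(A - A') + (B - B') = (A + B) - (A' + B')" by simp
    ultimately show "\<exists>A B. even (A + B) \<and> x 0 - y 0 = (int t + int k) * A \<and> x 1 - y 1 = (int t + 1) * B"
      by (intro exI[of _ "A - A'"] exI[of _ "B - B'"]) (simp only: right_diff_distrib dvd_diff simp_thms)
  next
    fix v :: "nat \<Rightarrow> int"
    obtain A B where "even (A + B)"
      "excess (int k - 1) (v 0 - (int t + int k)*A) + excess 1 (v 1 - (int t + 1)*B) \<le> int t"
      using ladder_tiling_plane_ex[of "int t" "int k" "v 0" "v 1"] assms by auto
    then show "\<exists>x :: nat \<Rightarrow> int. (\<exists>A B. even (A + B) \<and> v 0 - x 0 = (int t + int k) * A \<and> v 1 - x 1 = (int t + 1) * B) \<and>
        excess (int k - 1) (x 0) + excess 1 (x 1) \<le> int t"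
      by (intro exI[of _ "\<lambda>i. if i = 0 then v 0 - (int t + int k)*A else v 1 - (int t + 1)*B"]) auto
  next
    fix x y :: "nat \<Rightarrow> int" and i :: nat
    assume xy: "excess (int k - 1) (x 0) + excess 1 (x 1) \<le> int t"
      "excess (int k - 1) (y 0) + excess 1 (y 1) \<le> int t"
      and "\<exists>A B. even (A + B) \<and> x 0 - y 0 = (int t + int k) * A \<and> x 1 - y 1 = (int t + 1) * B"
      and i: "i < 2"
    then obtain A B where "even (A + B)" "x 0 - y 0 = (int t + int k) * A" "x 1 - y 1 = (int t + 1) * B"
      by blast
    then have "x 0 = y 0 \<and> x 1 = y 1"
      by (rule ladder_tiling_plane_uniq[OF _ _ xy, rotated 2]) (use assms in simp_all)
    moreover have "i = 0 \<or> i = 1" using i by linarith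
    ultimately show "x i = y i" by blast
  qed simp_all
  then show ?thesis by blast
qed

section \<open>Edges in dimension 3, radius 2\<close>

text \<open>Entry \<open>j\<close> is the only point \<open>(a, b, c)\<close> at distance at most 2 from the edge
  \<open>{(0, 0, 0), (1, 0, 0)}\<close> with \<open>a + 7b + 11c \<equiv> j\<close> modulo 38; the weights were found by search.\<close>
definition residue_table_38 :: "(int \<times> int \<times> int) list" where
  "residue_table_38 =
   [(0, 0, 0), (1, 0, 0), (2, 0, 0), (3, 0, 0), (0, -1, 1), (1, -1, 1),
    (-1, 1, 0), (0, 1, 0), (1, 1, 0), (2, 1, 0), (-1, 0, 1), (0, 0, 1),
    (1, 0, 1), (2, 0, 1), (0, 2, 0), (1, 2, 0), (0, 0, -2), (1, 0, -2),
    (0, 1, 1), (1, 1, 1), (0, -1, -1), (1, -1, -1), (0, 0, 2), (1, 0, 2),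
    (0, -2, 0), (1, -2, 0), (-1, 0, -1), (0, 0, -1), (1, 0, -1), (2, 0, -1),
    (-1, -1, 0), (0, -1, 0), (1, -1, 0), (2, -1, 0), (0, 1, -1), (1, 1, -1),
    (-2, 0, 0), (-1, 0, 0)]"

lemma residue_table_38_ex:
  "list_all (\<lambda>j. case residue_table_38 ! j of (a, b, c) \<Rightarrow>
     excess 1 a + \<bar>b\<bar> + \<bar>c\<bar> \<le> 2 \<and> (a + 7*b + 11*c) mod 38 = int j) [0..<38]"
  by code_simp

text \<open>The table is a left inverse of the residue map on the neighbourhood, all of which lies
  in the box searched; hence the map is injective there.\<close>

lemma residue_table_38_uniq:
  "list_all (\<lambda>a. list_all (\<lambda>b. list_all (\<lambda>c. excess 1 a + \<bar>b\<bar> + \<bar>c\<bar> \<le> 2 \<longrightarrow>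
     residue_table_38 ! nat ((a + 7*b + 11*c) mod 38) = (a, b, c)) [-2..2]) [-2..2]) [-2..3]"
  by code_simp

lemma edge_tiling_space_ex:
  fixes z :: int
  obtains a b c where "38 dvd z - (a + 7*b + 11*c)" "excess 1 a + \<bar>b\<bar> + \<bar>c\<bar> \<le> 2"
proof -
  define j where "j = nat (z mod 38)"
  have j: "j < 38" "int j = z mod 38" unfolding j_def by (simp_all add: nat_less_iff)
  obtain a b c where T: "residue_table_38 ! j = (a, b, c)" by (metis prod_cases3)
  have "j \<in> set [0..<38]" using j(1) by simp
  then have "case residue_table_38 ! j of (a, b, c) \<Rightarrow>
      excess 1 a + \<bar>b\<bar> + \<bar>c\<bar> \<le> 2 \<and> (a + 7*b + 11*c) mod 38 = int j"
    using residue_table_38_ex unfolding list_all_iff by (rule bspec[rotated])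
  then have "excess 1 a + \<bar>b\<bar> + \<bar>c\<bar> \<le> 2" "(a + 7*b + 11*c) mod 38 = z mod 38"
    using T j(2) by simp_all
  then show thesis by (intro that[of a b c]) (simp_all add: mod_eq_dvd_iff[symmetric])
qed

lemma edge_tiling_space_uniq:
  fixes a b c a' b' c' :: int
  assumes "excess 1 a + \<bar>b\<bar> + \<bar>c\<bar> \<le> 2" "excess 1 a' + \<bar>b'\<bar> + \<bar>c'\<bar> \<le> 2"
    and "38 dvd (a - a') + 7*(b - b') + 11*(c - c')"
  shows "a = a' \<and> b = b' \<and> c = c'"
proof -
  have *: "residue_table_38 ! nat ((a + 7*b + 11*c) mod 38) = (a, b, c)"
    if "excess 1 a + \<bar>b\<bar> + \<bar>c\<bar> \<le> 2" for a b c
  proof -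
    have "a \<in> set [-2..3]" "b \<in> set [-2..2]" "c \<in> set [-2..2]"
      using that unfolding excess_def by auto
    then show ?thesis using that residue_table_38_uniq by (simp only: list_all_iff)
  qed
  have "(a + 7*b + 11*c) - (a' + 7*b' + 11*c') = (a - a') + 7*(b - b') + 11*(c - c')"
    by simp
  then have eq: "(a + 7*b + 11*c) mod 38 = (a' + 7*b' + 11*c') mod 38"
    using assms(3) by (simp only: mod_eq_dvd_iff)
  have "(a, b, c) = (a', b', c')"
    by (rule trans[OF *[OF assms(1), symmetric, unfolded eq] *[OF assms(2)]])
  then show ?thesis by simp
qed

text \<open>Writing \<open>int 2 - 1\<close> keeps the form \<open>int k - 1\<close> of the general
  path box.\<close>

lemma edge_tiling_space:
  "\<exists>L. box_tiling 2 3 (\<lambda>i. if i = 0 then int 2 - 1 else 0) L"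
proof -
  have sum3: "(\<Sum>i<3. excess (if i = 0 then int 2 - 1 else 0) (x i)) =
      excess 1 (x 0) + \<bar>x 1\<bar> + \<bar>x 2\<bar>" for x :: "nat \<Rightarrow> int"
  proof -
    have "{2..<3::nat} = {2}" by auto
    then show ?thesis by (simp add: sum_lessThan_split_2)
  qed
  have "box_tiling 2 3 (\<lambda>i. if i = 0 then int 2 - 1 else 0)
      {l \<in> Zpow 3. 38 dvd l 0 + 7 * l 1 + 11 * l 2}"
  proof (rule box_tiling_latticeI, unfold sum3)
    fix x y :: "nat \<Rightarrow> int"
    assume "38 dvd x 0 + 7 * x 1 + 11 * x 2" "38 dvd y 0 + 7 * y 1 + 11 * y 2"
    from dvd_diff[OF this] show "38 dvd (x 0 - y 0) + 7 * (x 1 - y 1) + 11 * (x 2 - y 2)"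
      by (simp add: algebra_simps)
  next
    fix v :: "nat \<Rightarrow> int"
    obtain a b c where abc: "38 dvd (v 0 + 7 * v 1 + 11 * v 2) - (a + 7*b + 11*c)"
      "excess 1 a + \<bar>b\<bar> + \<bar>c\<bar> \<le> 2" by (rule edge_tiling_space_ex)
    have eq: "(v 0 + 7 * v 1 + 11 * v 2) - (a + 7*b + 11*c) =
      (v 0 - a) + 7 * (v 1 - b) + 11 * (v 2 - c)" by simp
    show "\<exists>x :: nat \<Rightarrow> int. 38 dvd (v 0 - x 0) + 7 * (v 1 - x 1) + 11 * (v 2 - x 2) \<and>
        excess 1 (x 0) + \<bar>x 1\<bar> + \<bar>x 2\<bar> \<le> int 2"
      using abc(2) abc(1)[unfolded eq]
      by (intro exI[of _ "\<lambda>i. if i = 0 then a else if i = 1 then b else c"]) simp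
  next
    fix x y :: "nat \<Rightarrow> int" and i :: nat
    assume "excess 1 (x 0) + \<bar>x 1\<bar> + \<bar>x 2\<bar> \<le> int 2" "excess 1 (y 0) + \<bar>y 1\<bar> + \<bar>y 2\<bar> \<le> int 2"
      "38 dvd (x 0 - y 0) + 7 * (x 1 - y 1) + 11 * (x 2 - y 2)" and i: "i < 3"
    then have "x 0 = y 0 \<and> x 1 = y 1 \<and> x 2 = y 2"
      by (intro edge_tiling_space_uniq) simp_all
    moreover have "i = 0 \<or> i = 1 \<or> i = 2" using i by linarith
    ultimately show "x i = y i" by blast
  qed simp_all
  then show ?thesis by blast
qed

section \<open>Paths in any dimension, radius 1\<close>

text \<open>An integer vector of l1-norm at most 1 is \<open>s\<close> times a basis vector. The
  zero vector gets \<open>s = 0\<close> with the default \<open>j = d\<close>, which need not be an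
  index; hence the conditional bound on \<open>j\<close>.\<close>

lemma sum_abs_le_1_cases:
  fixes x :: "nat \<Rightarrow> int"
  assumes "(\<Sum>i=d..<n. \<bar>x i\<bar>) \<le> 1"
  obtains j s where "d \<le> j" "s \<noteq> 0 \<longrightarrow> j < n"
    "\<forall>i\<in>{d..<n}. x i = (if i = j then s else 0)"
proof (cases "\<exists>j\<in>{d..<n}. x j \<noteq> 0")
  case False
  then show ?thesis by (intro that[of d 0]) auto
next
  case True
  then obtain j where j: "j \<in> {d..<n}" "x j \<noteq> 0" by blast
  have "(\<Sum>i=d..<n. \<bar>x i\<bar>) = \<bar>x j\<bar> + (\<Sum>i\<in>{d..<n}-{j}. \<bar>x i\<bar>)"
    using j(1) by (simp add: sum.remove)
  moreover have "(\<Sum>i\<in>{d..<n}-{j}. \<bar>x i\<bar>) \<ge> 0" by (simp add: sum_nonneg)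
  ultimately have "(\<Sum>i\<in>{d..<n}-{j}. \<bar>x i\<bar>) = 0" using assms j(2) by linarith
  then have "\<forall>i\<in>{d..<n}-{j}. x i = 0" by (simp add: sum_nonneg_eq_0_iff)
  then show ?thesis using j by (intro that[of j "x j"]) auto
qed

lemma sum_single_nonzero:
  fixes x c :: "nat \<Rightarrow> int"
  assumes "d \<le> j" "s \<noteq> 0 \<longrightarrow> j < n" "\<forall>i\<in>{d..<n}. x i = (if i = j then s else 0)"
  shows "(\<Sum>i=d..<n. c i * x i) = c j * s" "(\<Sum>i=d..<n. \<bar>x i\<bar>) = \<bar>s\<bar>"
proof -
  have "(\<Sum>i=d..<n. c i * x i) = (\<Sum>i=d..<n. if i = j then c i * s else 0)"
    using assms(3) by (intro sum.cong) auto
  then show "(\<Sum>i=d..<n. c i * x i) = c j * s" using assms(1,2) by (auto simp: sum.delta)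
  have "(\<Sum>i=d..<n. \<bar>x i\<bar>) = (\<Sum>i=d..<n. if i = j then \<bar>s\<bar> else 0)"
    using assms(3) by (intro sum.cong) auto
  then show "(\<Sum>i=d..<n. \<bar>x i\<bar>) = \<bar>s\<bar>" using assms(1,2) by (auto simp: sum.delta)
qed

lemma dvd_abs_less_imp_0: "(m::int) dvd d \<Longrightarrow> \<bar>d\<bar> < m \<Longrightarrow> d = 0"
  by (metis abs_of_pos dvd_imp_le_int dual_order.strict_trans1 abs_ge_zero not_less)

text \<open>Before reduction, the weights \<open>ik + 1\<close> map the neighbourhood of the path bijectively onto the
  window \<open>{-1 - (n - 1)k..nk}\<close> of \<open>(2n - 1)k + 2\<close> consecutive integers. Here \<open>(u, s, j)\<close> encodes
  the point \<open>u e\<^sub>0 + s e\<^sub>j\<close>, and \<open>j\<close> is irrelevant if \<open>s = 0\<close>.\<close>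
lemma path_tiling_1_uniq:
  fixes k n u s u' s' :: int and j j' :: int
  assumes k: "k \<ge> 1"
    and u: "excess (k-1) u + \<bar>s\<bar> \<le> 1" "s \<noteq> 0 \<longrightarrow> 1 \<le> j \<and> j \<le> n - 1"
    and u': "excess (k-1) u' + \<bar>s'\<bar> \<le> 1" "s' \<noteq> 0 \<longrightarrow> 1 \<le> j' \<and> j' \<le> n - 1"
    and n: "n \<ge> 1"
    and dvd: "2*(n*k) - k + 2 dvd (u + (j*k+1)*s) - (u' + (j'*k+1)*s')"
  shows "u = u' \<and> s = s' \<and> (s \<noteq> 0 \<longrightarrow> j = j')"
proof -
  \<comment> \<open>The three ranges for the weight \<open>p\<close> are disjoint, so
    \<open>p\<close> determines \<open>s\<close>.\<close>
  have range: "s = 0 \<and> -1 \<le> p \<and> p \<le> k \<and> p = u \<or>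
      s = 1 \<and> k+1 \<le> p \<and> p \<le> n*k \<and> 0 \<le> u \<and> u < k \<and> p = u + j*k + 1 \<or>
      s = -1 \<and> -1 - n*k + k \<le> p \<and> p \<le> -2 \<and> 0 \<le> u \<and> u < k \<and> p = u - j*k - 1"
    if "excess (k-1) u + \<bar>s\<bar> \<le> 1" "s \<noteq> 0 \<longrightarrow> 1 \<le> j \<and> j \<le> n - 1"
      and p: "p = u + (j*k+1)*s" for u s j p :: int
  proof -
    have "s = 0 \<or> s = 1 \<or> s = -1" using that(1) excess_nonneg[of "k-1" u] by linarith
    then show ?thesis
    proof (elim disjE)
      assume "s = 0"
      then show ?thesis using that(1) p k unfolding excess_def by auto
    next
      assume s: "s = 1"
      then have "1 * k \<le> j * k" "j * k \<le> (n-1) * k" using that(2) k by (auto intro!: mult_right_mono)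
      moreover have "(n-1)*k = n*k - k" by (simp add: algebra_simps)
      moreover have u: "0 \<le> u" "u < k" using that(1) s unfolding excess_def by auto
      moreover have p': "p = u + j*k + 1" using s p by simp
      ultimately have "k+1 \<le> p" "p \<le> n*k" by linarith+
      with s u p' show ?thesis by blast
    next
      assume s: "s = -1"
      then have "1 * k \<le> j * k" "j * k \<le> (n-1) * k" using that(2) k by (auto intro!: mult_right_mono)
      moreover have "(n-1)*k = n*k - k" by (simp add: algebra_simps)
      moreover have u: "0 \<le> u" "u < k" using that(1) s unfolding excess_def by auto
      moreover have p': "p = u - j*k - 1" using s p by (simp add: algebra_simps)
      ultimately have "-1 - n*k + k \<le> p" "p \<le> -2" by linarith+
      with s u p' show ?thesis by blast
    qed
  qed
  define p p' where "p = u + (j*k+1)*s" and "p' = u' + (j'*k+1)*s'"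
  note r = range[OF u p_def] and r' = range[OF u' p'_def]
  have "1*k \<le> n*k" using n k by (intro mult_right_mono) auto
  then have "\<bar>p - p'\<bar> < 2*(n*k) - k + 2" using r r' k by linarith
  then have pp: "p = p'" using dvd_abs_less_imp_0 dvd unfolding p_def p'_def by fastforce
  \<comment> \<open>For equal nonzero signs, \<open>u\<close> and \<open>j\<close> are recovered by
    division by \<open>k\<close>, since \<open>0 <= u < k\<close>.\<close>
  have jj: "j = j' \<and> u = u'" if "0 \<le> u" "u < k" "0 \<le> u'" "u' < k" "(j - j')*k = u' - u \<or> (j - j')*k = u - u'"
  proof -
    have "\<bar>(j - j')*k\<bar> < k" using that by linarith
    then have "(j - j')*k = 0" using dvd_abs_less_imp_0[of k "(j - j')*k"] by simp
    then show ?thesis using that k by auto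
  qed
  show ?thesis using r r'
  proof (elim disjE)
    assume "s = 1 \<and> k+1 \<le> p \<and> p \<le> n*k \<and> 0 \<le> u \<and> u < k \<and> p = u + j*k + 1"
      "s' = 1 \<and> k+1 \<le> p' \<and> p' \<le> n*k \<and> 0 \<le> u' \<and> u' < k \<and> p' = u' + j'*k + 1"
    note * = this
    have "j*k - j'*k = u' - u" using * pp by linarith
    then have "(j - j')*k = u' - u" by (simp only: left_diff_distrib)
    then have "j = j' \<and> u = u'" using * by (intro jj) blast+
    with * show ?thesis by blast
  next
    assume "s = -1 \<and> -1 - n*k + k \<le> p \<and> p \<le> -2 \<and> 0 \<le> u \<and> u < k \<and> p = u - j*k - 1"
      "s' = -1 \<and> -1 - n*k + k \<le> p' \<and> p' \<le> -2 \<and> 0 \<le> u' \<and> u' < k \<and> p' = u' - j'*k - 1"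
    note * = this
    have "j*k - j'*k = u - u'" using * pp by linarith
    then have "(j - j')*k = u - u'" by (simp only: left_diff_distrib)
    then have "j = j' \<and> u = u'" using * by (intro jj) blast+
    with * show ?thesis by blast
  qed (use pp k in auto)
qed

text \<open>Reduce \<open>z\<close> to \<open>p\<close> in the window. The part from -1 to
  \<open>k\<close> is the line of the path; above it, dividing \<open>p - 1\<close> by
  \<open>k\<close> gives \<open>j\<close> and remainder \<open>u\<close>; below it, dividing
  \<open>p + 1\<close> gives \<open>-j\<close>. The window ends ensure
  \<open>j <= n - 1\<close>.\<close>

lemma path_tiling_1_ex:
  fixes k n z :: int
  assumes k: "k \<ge> 1" and n: "n \<ge> 1"
  obtains u s j where "2*(n*k) - k + 2 dvd z - (u + (j*k+1)*s)"
    "excess (k-1) u + \<bar>s\<bar> \<le> 1" "1 \<le> j" "s \<noteq> 0 \<longrightarrow> j \<le> n - 1"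
proof -
  have nk: "1*k \<le> n*k" using n k by (intro mult_right_mono) auto
  then have "2*(n*k) - k + 2 > 0" using k by linarith
  then obtain c where "-1 - n*k + k \<le> z - (2*(n*k) - k + 2)*c"
      "z - (2*(n*k) - k + 2)*c < (-1 - n*k + k) + (2*(n*k) - k + 2)"
    by (rule ex_mod_in_window)
  moreover define p where "p = z - (2*(n*k) - k + 2)*c"
  ultimately have p: "-1 - n*k + k \<le> p" "p \<le> n*k" "2*(n*k) - k + 2 dvd z - p"
    by (linarith, linarith, simp)
  have k0: "k > 0" using k by simp
  consider "-1 \<le> p" "p \<le> k" | "p > k" | "p < -1" by linarith
  then show thesis
  proof cases
    case 1
    \<comment> \<open>\<open>j = 1\<close> is a default value, as \<open>s = 0\<close>.\<close>
    then show thesis using p(3) k by (intro that[of p 1 0]) (auto simp: excess_def)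
  next
    case 2
    obtain j where j: "0 \<le> (p-1) - k*j" "(p-1) - k*j < 0 + k" using ex_mod_in_window[OF k0] by blast
    have "1 \<le> j"
    proof (rule ccontr)
      assume "\<not> 1 \<le> j"
      then have "k*j \<le> k*0" using k by (intro mult_left_mono) auto
      with j 2 show False by linarith
    qed
    moreover have "j \<le> n - 1"
    proof (rule ccontr)
      assume "\<not> j \<le> n - 1"
      then have "k*n \<le> k*j" using k by (intro mult_left_mono) auto
      with j p(2) mult.commute[of n k] show False by linarith
    qed
    moreover have "((p-1) - k*j) + (j*k+1)*1 = p" by (simp add: algebra_simps)
    ultimately show thesis
      using p(3) j by (intro that[of "(p-1) - k*j" j 1]) (auto simp: excess_def)
  next
    case 3
    obtain j where j: "0 \<le> (p+1) - k*j" "(p+1) - k*j < 0 + k" using ex_mod_in_window[OF k0] by blast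
    have "j \<le> -1"
    proof (rule ccontr)
      assume "\<not> j \<le> -1"
      then have "k*0 \<le> k*j" using k by (intro mult_left_mono) auto
      with j 3 show False by linarith
    qed
    moreover have "-j \<le> n - 1"
    proof (rule ccontr)
      assume "\<not> -j \<le> n - 1"
      then have "k*j \<le> k*(-n)" using k by (intro mult_left_mono) auto
      moreover have "k*(-n) = -(n*k)" by simp
      ultimately show False using j p(1) by linarith
    qed
    moreover have "((p+1) - k*j) + ((-j)*k+1)*(-1) = p" by (simp add: algebra_simps)
    ultimately show thesis
      using p(3) j by (intro that[of "(p+1) - k*j" "-j" "-1"]) (auto simp: excess_def)
  qed
qed

lemma path_tiling_1:
  assumes "n \<ge> 1" "k \<ge> 1"
  shows "\<exists>L. box_tiling 1 n (\<lambda>i. if i = 0 then int k - 1 else 0) L"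
proof -
  \<comment> \<open>The size of the neighbourhood: \<open>k\<close> path vertices, 2 points beyond
    the ends, and \<open>2*(n-1)\<close> parallel copies of the path.\<close>
  define m where "m = 2 * (int n * int k) - int k + 2"
  define f where "f x = (\<Sum>i<n. (int i * int k + 1) * x i)" for x :: "nat \<Rightarrow> int"
  have f_diff: "f (\<lambda>i. x i - y i) = f x - f y" for x y
    by (simp add: f_def sum_subtractf right_diff_distrib)
  have f_split: "f x = x 0 + (\<Sum>i=1..<n. (int i * int k + 1) * x i)" for x
    using assms(1) by (simp add: f_def sum_lessThan_split_1)
  have dist: "(\<Sum>i<n. excess (if i = 0 then int k - 1 else 0) (x i)) =
      excess (int k - 1) (x 0) + (\<Sum>i=1..<n. \<bar>x i\<bar>)" for x
    using assms(1) by (simp add: sum_lessThan_split_1)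
  have "box_tiling 1 n (\<lambda>i. if i = 0 then int k - 1 else 0) {l \<in> Zpow n. m dvd f l}"
  proof (rule box_tiling_latticeI, unfold dist f_diff)
    fix x y assume "m dvd f x" "m dvd f y"
    then show "m dvd f x - f y" by (rule dvd_diff)
  next
    fix x y :: "nat \<Rightarrow> int" assume "\<And>i. i < n \<Longrightarrow> x i = y i" "m dvd f x"
    then show "m dvd f y" by (simp add: f_def)
  next
    fix v
    obtain u s j where *: "m dvd f v - (u + (j * int k + 1) * s)"
      "excess (int k - 1) u + \<bar>s\<bar> \<le> 1" "1 \<le> j" "s \<noteq> 0 \<longrightarrow> j \<le> int n - 1"
      by (rule path_tiling_1_ex[of "int k" "int n" "f v", folded m_def]) (use assms in auto)
    define x where "x i = (if i = 0 then u else if i = nat j then s else 0)" for i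
    have "(\<Sum>i=1..<n. (int i * int k + 1) * x i) = (int (nat j) * int k + 1) * s"
      "(\<Sum>i=1..<n. \<bar>x i\<bar>) = \<bar>s\<bar>"
      by (rule sum_single_nonzero; use *(3,4) in \<open>auto simp: x_def\<close>)+
    then show "\<exists>x. m dvd f v - f x \<and> excess (int k - 1) (x 0) + (\<Sum>i=1..<n. \<bar>x i\<bar>) \<le> int 1"
      using * by (intro exI[of _ x]) (simp add: f_split x_def)
  next
    fix x y :: "nat \<Rightarrow> int" and i
    assume x: "excess (int k - 1) (x 0) + (\<Sum>i=1..<n. \<bar>x i\<bar>) \<le> int 1"
      and y: "excess (int k - 1) (y 0) + (\<Sum>i=1..<n. \<bar>y i\<bar>) \<le> int 1"
      and m: "m dvd f x - f y" and i: "i < n"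
    have "(\<Sum>i=1..<n. \<bar>x i\<bar>) \<le> 1" using x excess_nonneg[of "int k - 1" "x 0"] by linarith
    then obtain j s where js: "1 \<le> j" "s \<noteq> 0 \<longrightarrow> j < n"
      "\<forall>i\<in>{1..<n}. x i = (if i = j then s else 0)" by (rule sum_abs_le_1_cases)
    have "(\<Sum>i=1..<n. \<bar>y i\<bar>) \<le> 1" using y excess_nonneg[of "int k - 1" "y 0"] by linarith
    then obtain j' s' where js': "1 \<le> j'" "s' \<noteq> 0 \<longrightarrow> j' < n"
      "\<forall>i\<in>{1..<n}. y i = (if i = j' then s' else 0)" by (rule sum_abs_le_1_cases)
    note sx = sum_single_nonzero[OF js] and sy = sum_single_nonzero[OF js']
    have "x 0 = y 0 \<and> s = s' \<and> (s \<noteq> 0 \<longrightarrow> int j = int j')"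
    proof (rule path_tiling_1_uniq[of "int k" "x 0" s "int j" "int n"])
      show "2 * (int n * int k) - int k + 2 dvd
          x 0 + (int j * int k + 1) * s - (y 0 + (int j' * int k + 1) * s')"
        using m unfolding m_def f_split sx(1) sy(1) .
    qed (use assms js(1,2) js'(1,2) x y sx(2) sy(2) in auto)
    then show "x i = y i" using js(3) js'(3) i by (cases "i = 0") auto
  qed
  then show ?thesis by blast
qed

section \<open>Squares in dimension 3r+2, radius 1\<close>

text \<open>The neighbourhood meets the plane of the square in 4 + 8 = 12 points, one for each
  residue modulo 12.\<close>

lemma square_tiling_1_plane_table:
  "list_all (\<lambda>z. list_ex (\<lambda>a. list_ex (\<lambda>b. 12 dvd z - (2*a + 3*b) \<and> excess 1 a + excess 1 b \<le> 1)
     [-1..2]) [-1..2]) [0..11::int]"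
  by code_simp

text \<open>The corners have weights 0, 2, 3, 5, one for each class modulo 4, and
  \<open>4*c*s\<close> then reaches every residue modulo 12.\<close>

lemma square_tiling_1_layer_table:
  "list_all (\<lambda>s. list_all (\<lambda>z. list_ex (\<lambda>a. list_ex (\<lambda>b. list_ex (\<lambda>c.
     12 dvd z - (2*a + 3*b + 4*c*s)) [0..2]) [0..1]) [0..1]) [0..11]) [-1,1::int]"
  by code_simp

lemma dvd_diff_mod: "(m::int) dvd z mod m - y \<Longrightarrow> m dvd z - y"
  by (simp add: mod_eq_dvd_iff[symmetric])

lemma square_tiling_1_plane_ex:
  fixes z :: int
  obtains a b where "12 dvd z - (2*a + 3*b)" "excess 1 a + excess 1 b \<le> 1"
proof -
  have "z mod 12 \<in> set [0..11]" by simp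
  then have "list_ex (\<lambda>a. list_ex (\<lambda>b. 12 dvd z mod 12 - (2*a + 3*b) \<and> excess 1 a + excess 1 b \<le> 1)
     [-1..2]) [-1..2]"
    using square_tiling_1_plane_table unfolding list_all_iff by (rule bspec[rotated])
  then obtain a b where "12 dvd z mod 12 - (2*a + 3*b)" "excess 1 a + excess 1 b \<le> 1"
    unfolding list_ex_iff by blast
  then show thesis using that dvd_diff_mod by blast
qed

lemma square_tiling_1_layer_ex:
  fixes z s :: int
  assumes "s = 1 \<or> s = -1"
  obtains a b c where "12 dvd z - (2*a + 3*b + 4*c*s)" "0 \<le> a" "a \<le> 1" "0 \<le> b" "b \<le> 1" "0 \<le> c" "c \<le> 2"
proof -
  have "s \<in> set [-1, 1]" using assms by auto
  then have "list_all (\<lambda>z. list_ex (\<lambda>a. list_ex (\<lambda>b. list_ex (\<lambda>c.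
     12 dvd z - (2*a + 3*b + 4*c*s)) [0..2]) [0..1]) [0..1]) [0..11]"
    using square_tiling_1_layer_table unfolding list_all_iff[of _ "[-1,1]"] by (rule bspec[rotated])
  moreover have "z mod 12 \<in> set [0..11]" by simp
  ultimately have "list_ex (\<lambda>a. list_ex (\<lambda>b. list_ex (\<lambda>c.
     12 dvd z mod 12 - (2*a + 3*b + 4*c*s)) [0..2]) [0..1]) [0..1]"
    unfolding list_all_iff by (rule bspec)
  then obtain a b c where "a \<in> set [0..1]" "b \<in> set [0..1]" "c \<in> set [0..2]"
    "12 dvd z mod 12 - (2*a + 3*b + 4*c*s)" unfolding list_ex_iff by blast
  then show thesis using that dvd_diff_mod by (metis atLeastAtMost_iff set_upto)
qed

text \<open>All weights lie between -3 and 8, so congruent weights are equal. Then the differences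
  of \<open>a\<close> and \<open>b\<close> are \<open>3*c\<close> and \<open>-2*c\<close>, at
  l1-distance \<open>5*|c|\<close>; the neighbourhood allows only 4.\<close>

lemma square_tiling_1_plane_uniq:
  fixes a b a' b' :: int
  assumes "excess 1 a + excess 1 b \<le> 1" "excess 1 a' + excess 1 b' \<le> 1"
    and "12 dvd (2*a + 3*b) - (2*a' + 3*b')"
  shows "a = a' \<and> b = b'"
proof -
  have "(2*a + 3*b) - (2*a' + 3*b') = 0"
  proof (rule dvd_abs_less_imp_0[OF assms(3)])
    have "-3 \<le> 2*a + 3*b \<and> 2*a + 3*b \<le> 8" if "excess 1 a + excess 1 b \<le> 1" for a b
      using that unfolding excess_def by linarith
    from this[OF assms(1)] this[OF assms(2)] show "\<bar>(2*a + 3*b) - (2*a' + 3*b')\<bar> < 12" by linarith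
  qed
  then have "2*(a - a') = 3*(b' - b)" by simp
  moreover from this have "\<exists>c. a - a' = 3*c" by presburger
  then obtain c where "a - a' = 3*c" ..
  ultimately have "a - a' = 3*c" "b' - b = 2*c" by simp_all
  moreover have "\<bar>a - a'\<bar> + \<bar>b - b'\<bar> \<le> 4"
    using assms(1,2) abs_diff_le_excess[of 1 a a'] abs_diff_le_excess[of 1 b b'] by linarith
  ultimately have "a - a' = 3*c" "b' - b = 2*c" "c = 0" by linarith+
  then show ?thesis by simp
qed

text \<open>The coordinates are recovered one after the other: \<open>b\<close> modulo 2, then
  \<open>a\<close> modulo 4, then \<open>c\<close> modulo 3.\<close>

lemma square_tiling_1_layer_uniq:
  fixes a b c a' b' c' s :: int
  assumes "s = 1 \<or> s = -1" "0 \<le> a" "a \<le> 1" "0 \<le> b" "b \<le> 1" "0 \<le> c" "c \<le> 2"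
    "0 \<le> a'" "a' \<le> 1" "0 \<le> b'" "b' \<le> 1" "0 \<le> c'" "c' \<le> 2"
    and dvd: "12 dvd (2*a + 3*b + 4*c*s) - (2*a' + 3*b' + 4*c'*s)"
  shows "a = a' \<and> b = b' \<and> c = c'"
proof -
  define e where "e = s * (c - c')"
  have "(2*a + 3*b + 4*c*s) - (2*a' + 3*b' + 4*c'*s) = 2*(a-a') + 3*(b-b') + 4*e"
    by (simp add: e_def algebra_simps)
  with dvd obtain q where q: "2*(a-a') + 3*(b-b') + 4*e = 12*q" by (metis dvdE)
  have "e = c - c' \<or> e = c' - c" using assms(1) by (auto simp: e_def)
  moreover have "even (b-b')" using q by presburger
  then have "b = b'" using assms(4,5,10,11) by presburger
  moreover from this q have "even (a-a')" by presburger
  then have "a = a'" using assms(2,3,8,9) by presburger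
  ultimately show ?thesis using q assms(6,7,12,13) by presburger
qed

text \<open>The \<open>12*(2*r+1)\<close> points of the neighbourhood fall into \<open>2*r+1\<close>
  layers of 12: the plane of the square and, for each \<open>l\<close> from 1 to \<open>r\<close>,
  one layer per sign. \<open>g\<close> identifies the layer, \<open>f\<close> the point inside
  it.\<close>

lemma square_tiling_1:
  assumes n: "n = 3 * r + 2"
  shows "\<exists>L. box_tiling 1 n (\<lambda>i. if i = 0 then int 2 - 1 else if i = 1 then 1 else 0) L"
proof -
  define m where "m = 2 * int r + 1"
  \<comment> \<open>Quotient and remainder of \<open>i - 2\<close> by 3 number the extra
    \<open>3*r\<close> directions by layer and by position in it.\<close>
  define c where "c i = 4 * int ((i - 2) mod 3)" for i :: nat
  define h where "h i = int ((i - 2) div 3) + 1" for i :: nat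
  define f where "f x = 2 * x 0 + 3 * x 1 + (\<Sum>i=2..<n. c i * x i)" for x :: "nat \<Rightarrow> int"
  define g where "g x = (\<Sum>i=2..<n. h i * x i)" for x :: "nat \<Rightarrow> int"
  have diff: "f (\<lambda>i. x i - y i) = f x - f y" "g (\<lambda>i. x i - y i) = g x - g y" for x y
    by (simp_all add: f_def g_def sum_subtractf right_diff_distrib)
  have dist: "(\<Sum>i<n. excess (if i = 0 then int 2 - 1 else if i = 1 then 1 else 0) (x i)) =
      excess 1 (x 0) + excess 1 (x 1) + (\<Sum>i=2..<n. \<bar>x i\<bar>)" for x
    using n by (simp add: sum_lessThan_split_2)
  have h_bounds: "1 \<le> h j \<and> h j \<le> int r" if "2 \<le> j" "j < n" for j
  proof -
    have "(j - 2) div 3 < r" using that n by (simp add: less_mult_imp_div_less)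
    then show ?thesis by (simp add: h_def)
  qed
  have "box_tiling 1 n (\<lambda>i. if i = 0 then int 2 - 1 else if i = 1 then 1 else 0)
      {l \<in> Zpow n. 12 dvd f l \<and> m dvd g l}"
  proof (rule box_tiling_latticeI, unfold dist diff)
    fix x y assume "12 dvd f x \<and> m dvd g x" "12 dvd f y \<and> m dvd g y"
    then show "12 dvd f x - f y \<and> m dvd g x - g y" by (blast intro: dvd_diff)
  next
    fix x y :: "nat \<Rightarrow> int" assume "\<And>i. i < n \<Longrightarrow> x i = y i" "12 dvd f x \<and> m dvd g x"
    moreover from this have "f x = f y" "g x = g y" using n by (simp_all add: f_def g_def)
    ultimately show "12 dvd f y \<and> m dvd g y" by simp
  next
    fix v
    have "\<exists>a b j s. 2 \<le> j \<and> (s \<noteq> 0 \<longrightarrow> j < n) \<and> 12 dvd f v - (2*a + 3*b + c j * s) \<and>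
        m dvd g v - h j * s \<and> excess 1 a + excess 1 b + \<bar>s\<bar> \<le> 1"
    proof -
      have "m > 0" by (simp add: m_def)
      then obtain d where "- int r \<le> g v - m*d" "g v - m*d < - int r + m" by (rule ex_mod_in_window)
      moreover define q where "q = g v - m*d"
      ultimately have q: "\<bar>q\<bar> \<le> int r" "m dvd g v - q" by (simp_all add: m_def)
      show ?thesis
      proof (cases "q = 0")
        case True
        obtain a b where "12 dvd f v - (2*a + 3*b)" "excess 1 a + excess 1 b \<le> 1"
          by (rule square_tiling_1_plane_ex)
        with q True show ?thesis
          \<comment> \<open>The direction 2 is a default, as \<open>s = 0\<close>.\<close>
          by (intro exI[of _ a] exI[of _ b] exI[of _ 2] exI[of _ 0]) simp
      next
        case False
        define s where "s = sgn q"
        have s: "s = 1 \<or> s = -1" "\<bar>q\<bar> * s = q" using False by (auto simp: s_def sgn_if)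
        obtain a b e where abe: "12 dvd f v - (2*a + 3*b + 4*e*s)"
          "0 \<le> a" "a \<le> 1" "0 \<le> b" "b \<le> 1" "0 \<le> e" "e \<le> 2"
          using square_tiling_1_layer_ex[OF s(1)] by blast
        \<comment> \<open>The inverse of the numbering: the direction in layer \<open>|q|\<close> at
          position \<open>e\<close>.\<close>
        define j where "j = 3 * nat (\<bar>q\<bar> - 1) + nat e + 2"
        have "nat e < 3" using abe by linarith
        then have "(3 * nat (\<bar>q\<bar> - 1) + nat e) div 3 = nat (\<bar>q\<bar> - 1)"
          "(3 * nat (\<bar>q\<bar> - 1) + nat e) mod 3 = nat e" by simp_all
        then have "h j = \<bar>q\<bar>" "c j = 4*e" using False abe by (simp_all add: h_def c_def j_def)
        moreover have "j < n" using q(1) False abe n unfolding j_def by linarith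
        moreover have "excess 1 a + excess 1 b + \<bar>s\<bar> \<le> 1" using abe s(1) by (auto simp: excess_def)
        ultimately show ?thesis using q(2) abe(1) s(2)
          by (intro exI[of _ a] exI[of _ b] exI[of _ j] exI[of _ s]) (simp add: j_def)
      qed
    qed
    then obtain a b j s where *: "2 \<le> j" "s \<noteq> 0 \<longrightarrow> j < n"
      "12 dvd f v - (2*a + 3*b + c j * s)" "m dvd g v - h j * s"
      "excess 1 a + excess 1 b + \<bar>s\<bar> \<le> 1" by blast
    define x where "x i = (if i = 0 then a else if i = 1 then b else if i = j then s else 0)" for i :: nat
    have x: "\<forall>i\<in>{2..<n}. x i = (if i = j then s else 0)" by (simp add: x_def)
    show "\<exists>x. (12 dvd f v - f x \<and> m dvd g v - g x) \<and>
        excess 1 (x 0) + excess 1 (x 1) + (\<Sum>i=2..<n. \<bar>x i\<bar>) \<le> int 1"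
      using * sum_single_nonzero[OF *(1,2) x]
      by (intro exI[of _ x]) (simp add: f_def g_def, simp add: x_def)
  next
    fix x y :: "nat \<Rightarrow> int" and i
    assume x: "excess 1 (x 0) + excess 1 (x 1) + (\<Sum>i=2..<n. \<bar>x i\<bar>) \<le> int 1"
      and y: "excess 1 (y 0) + excess 1 (y 1) + (\<Sum>i=2..<n. \<bar>y i\<bar>) \<le> int 1"
      and m: "12 dvd f x - f y \<and> m dvd g x - g y" and i: "i < n"
    have "(\<Sum>i=2..<n. \<bar>x i\<bar>) \<le> 1"
      using x excess_nonneg[of 1 "x 0"] excess_nonneg[of 1 "x 1"] by linarith
    then obtain j s where js: "2 \<le> j" "s \<noteq> 0 \<longrightarrow> j < n"
      "\<forall>i\<in>{2..<n}. x i = (if i = j then s else 0)" by (rule sum_abs_le_1_cases)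
    have "(\<Sum>i=2..<n. \<bar>y i\<bar>) \<le> 1"
      using y excess_nonneg[of 1 "y 0"] excess_nonneg[of 1 "y 1"] by linarith
    then obtain j' s' where js': "2 \<le> j'" "s' \<noteq> 0 \<longrightarrow> j' < n"
      "\<forall>i\<in>{2..<n}. y i = (if i = j' then s' else 0)" by (rule sum_abs_le_1_cases)
    note sx = sum_single_nonzero[OF js] and sy = sum_single_nonzero[OF js']
    have xs: "excess 1 (x 0) + excess 1 (x 1) + \<bar>s\<bar> \<le> 1"
      and ys: "excess 1 (y 0) + excess 1 (y 1) + \<bar>s'\<bar> \<le> 1" using x y sx(2) sy(2) by simp_all
    have bound: "\<bar>h j * s\<bar> \<le> int r \<and> (s = 0 \<or> (s = 1 \<or> s = -1) \<and> sgn (h j * s) = s \<and> \<bar>h j * s\<bar> = h j)"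
      if "2 \<le> j" "s \<noteq> 0 \<longrightarrow> j < n" "excess 1 u + excess 1 w + \<bar>s\<bar> \<le> 1" for j s u w
    proof -
      have "s = 0 \<or> s = 1 \<or> s = -1"
        using that(3) excess_nonneg[of 1 u] excess_nonneg[of 1 w] by linarith
      then show ?thesis using h_bounds[OF that(1)] that(2) by auto
    qed
    note bx = bound[OF js(1,2) xs] and by' = bound[OF js'(1,2) ys]
    \<comment> \<open>Both values lie in \<open>[-r, r]\<close>, a complete residue system modulo
      \<open>2*r+1\<close>, so \<open>g\<close> determines the sign and the layer.\<close>
    have "h j * s - h j' * s' = 0"
    proof (rule dvd_abs_less_imp_0)
      show "m dvd h j * s - h j' * s'" using m by (simp add: g_def sx(1) sy(1))
      show "\<bar>h j * s - h j' * s'\<bar> < m" using bx by' unfolding m_def by linarith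
    qed
    then have hs: "h j * s = h j' * s'" by simp
    have f12: "12 dvd (2 * x 0 + 3 * x 1 + c j * s) - (2 * y 0 + 3 * y 1 + c j' * s')"
      using m by (simp add: f_def sx(1) sy(1))
    have "x 0 = y 0 \<and> x 1 = y 1 \<and> s = s' \<and> (s \<noteq> 0 \<longrightarrow> j = j')"
    proof (cases "s = 0")
      case True
      then have "s' = 0" using hs by' by auto
      with True show ?thesis
        using square_tiling_1_plane_uniq[of "x 0" "x 1" "y 0" "y 1"] xs ys f12 by simp
    next
      case False
      then have "s' \<noteq> 0" using hs bx by auto
      with False have s: "s = s'" "h j = h j'" "s = 1 \<or> s = -1" using hs bx by' by auto
      \<comment> \<open>A nonzero \<open>s\<close> exhausts the radius 1, so the first two
        coordinates form a corner of the square.\<close>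
      have z: "0 \<le> u \<and> u \<le> 1 \<and> 0 \<le> w \<and> w \<le> 1" if "excess 1 u + excess 1 w + \<bar>s\<bar> \<le> 1" for u w
        using that s(3) unfolding excess_def by auto
      have "x 0 = y 0 \<and> x 1 = y 1 \<and> int ((j - 2) mod 3) = int ((j' - 2) mod 3)"
        using f12 z[OF xs] z[OF ys[folded s(1)]]
        unfolding c_def s(1)[symmetric]
        by (intro square_tiling_1_layer_uniq[OF s(3)]) auto
      moreover from this s(2) have "j - 2 = j' - 2"
        unfolding h_def by (metis add_right_cancel of_nat_eq_iff mult_div_mod_eq)
      then have "j = j'" using js(1) js'(1) by simp
      ultimately show ?thesis using s(1) by simp
    qed
    then show "x i = y i"
      using js(3) js'(3) i by (cases "i = 0 \<or> i = 1") auto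
  qed
  then show ?thesis by blast
qed

section \<open>Existence of the dominating sets\<close>

theorem theorem2:
  fixes t n :: nat and H :: "'h sgraph"
  assumes "t \<ge> 1" and "n \<ge> 1" and "finite_graph H"
    and "(t = 1 \<and> n \<ge> 2 \<and> (\<exists>k\<ge>1. graph_isomorphic H (path_graph k))) \<or>
         (n = 2 \<and> (\<exists>k\<ge>1. graph_isomorphic H (path_graph k))) \<or>
         (n = 2 \<and> (\<exists>k\<ge>2. graph_isomorphic H (cartesian_product (path_graph 2) (path_graph k)))) \<or>
         (t = 1 \<and> (\<exists>r. n = 3 * r + 2) \<and>
            graph_isomorphic H (cartesian_product (path_graph 2) (path_graph 2))) \<or>
         (t = 2 \<and> n = 3 \<and> graph_isomorphic H (path_graph 2))"
  shows "\<exists>S. PDDS_of t n H S"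
proof -
  \<comment> \<open>Only two box shapes occur; with the components settled for each, every case has
    just its tiling to supply.\<close>
  have path: ?thesis
    if k: "k \<ge> 1" and H: "graph_isomorphic H (path_graph k)"
      and til: "\<exists>L. box_tiling t n (\<lambda>i. if i = 0 then int k - 1 else 0) L" for k
  proof -
    obtain L where "box_tiling t n (\<lambda>i. if i = 0 then int k - 1 else 0) L" using til ..
    then show ?thesis
      by (rule PDDS_of_box_tiling[OF _ \<open>t \<ge> 1\<close> _ box_isomorphic_path[OF \<open>n \<ge> 1\<close>] H])
        (use k in simp)
  qed
  have ladder: ?thesis
    if n2: "n \<ge> 2" and k: "k \<ge> 1" and H: "graph_isomorphic H (cartesian_product (path_graph 2) (path_graph k))"
      and til: "\<exists>L. box_tiling t n (\<lambda>i. if i = 0 then int k - 1 else if i = 1 then 1 else 0) L" for k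
  proof -
    obtain L where "box_tiling t n (\<lambda>i. if i = 0 then int k - 1 else if i = 1 then 1 else 0) L"
      using til ..
    then show ?thesis
      by (rule PDDS_of_box_tiling[OF _ \<open>t \<ge> 1\<close> _ box_isomorphic_ladder[OF n2] H])
        (use k in simp)
  qed
  from assms(4) show ?thesis
  proof (elim disjE)
    assume "t = 1 \<and> n \<ge> 2 \<and> (\<exists>k\<ge>1. graph_isomorphic H (path_graph k))"
    then show ?thesis using path path_tiling_1[OF \<open>n \<ge> 1\<close>] by blast
  next
    assume "n = 2 \<and> (\<exists>k\<ge>1. graph_isomorphic H (path_graph k))"
    then show ?thesis using path path_tiling_plane[OF \<open>t \<ge> 1\<close>] by blast
  next
    assume "n = 2 \<and> (\<exists>k\<ge>2. graph_isomorphic H (cartesian_product (path_graph 2) (path_graph k)))"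
    then obtain k where "n = 2" "k \<ge> 2"
      "graph_isomorphic H (cartesian_product (path_graph 2) (path_graph k))" by blast
    then show ?thesis using ladder[of k] ladder_tiling_plane[OF \<open>t \<ge> 1\<close>, of k] by simp
  next
    assume "t = 1 \<and> (\<exists>r. n = 3 * r + 2) \<and>
      graph_isomorphic H (cartesian_product (path_graph 2) (path_graph 2))"
    then obtain r where "t = 1" "n = 3 * r + 2"
      "graph_isomorphic H (cartesian_product (path_graph 2) (path_graph 2))" by blast
    then show ?thesis using ladder[of 2] square_tiling_1 by simp
  next
    assume "t = 2 \<and> n = 3 \<and> graph_isomorphic H (path_graph 2)"
    then show ?thesis using path[of 2] edge_tiling_space by simp
  qed
qed

end
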